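(* There exists a function $g:\mathbb{N}\to[0,\infty)$ with $g(n)/n\to0$ as $n\to\infty$ such that the following holds. Let $0\le p\le 1/2$ and $\tau\in(0,1)$, and let $\alpha=\mathrm{H}(p)$ and $\beta=\mathrm{H}(N(p,\tau))$. Then for all sufficiently large $n$, for every binary string $x$ of length $n$ with $\mathrm{C}(x)\ge\alpha n$, $$\Pr\big[\mathrm{C}(N_\tau(x))\ge \beta n-g(n)\big]\ \ge\ 1-\frac1n .$$ (The function $g$ does not depend on $\alpha,\beta,\tau$.)
   Context: $\mathrm{C}(x)$ denotes the plain Kolmogorov complexity of the binary string $x$: the minimal length of a binary program that produces $x$, with respect to a fixed optimal programming language (one for which the complexity function is minimal up to an additive $O(1)$ term). $\mathrm{H}(p)=-p\log p-(1-p)\log(1-p)$ is the binary Shannon entropy function (logarithms base 2, $0\log0=0$). $N(p,\tau)=p(1-\tau)+(1-p)\tau=p+\tau-2p\tau$. For $x\in\{0,1\}^n$, $N_\tau(x)$ is the random string obtained from $x$ by flipping each bit independently with probability $\tau$; the probability is over this noise. *)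

theory Defs
  imports "HOL-Probability.Probability"
begin

datatype recf =
    Zero
  | Succ
  | Proj nat
  | Comp recf "recf list"
  | PrimRec recf recf
  | Mu recf

text \<open>
  Arities are not tracked syntactically; an argument list that is too short makes the result
  undefined. On argument lists of any fixed length the denoted functions are exactly the partial
  recursive ones. Recursion and minimisation act on the first argument; the step function of a
  primitive recursion receives the counter, the previous value and the parameters, in this order.
  As usual, minimisation requires all values before the first zero to be defined.
\<close>

fun recf_eval :: "recf \<Rightarrow> nat list \<Rightarrow> nat option" where
  "recf_eval Zero xs = Some 0"
| "recf_eval Succ xs = (case xs of [] \<Rightarrow> None | x # _ \<Rightarrow> Some (Suc x))"
| "recf_eval (Proj i) xs = (if i < length xs then Some (xs ! i) else None)"
| "recf_eval (Comp f gs) xs =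
     Option.bind (those (map (\<lambda>g. recf_eval g xs) gs)) (\<lambda>vs. recf_eval f vs)"
| "recf_eval (PrimRec f g) xs =
     (case xs of
        [] \<Rightarrow> None
      | n # ys \<Rightarrow>
          rec_nat (recf_eval f ys)
            (\<lambda>k r. Option.bind r (\<lambda>v. recf_eval g (k # v # ys))) n)"
| "recf_eval (Mu f) xs =
     (if \<exists>z. recf_eval f (z # xs) = Some 0 \<and>
             (\<forall>y<z. \<exists>v. recf_eval f (y # xs) = Some (Suc v))
      then Some (LEAST z. recf_eval f (z # xs) = Some 0)
      else None)"

type_synonym bstring = "bool list"

text \<open>Bijective base-2 numeration.\<close>

fun bstring_code :: "bstring \<Rightarrow> nat" where
  "bstring_code [] = 0"
| "bstring_code (b # bs) = 2 * bstring_code bs + (if b then 2 else 1)"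

lemma bij_bstring_code: "bij bstring_code"
proof (rule bijI)
  have "bstring_code xs = bstring_code ys \<Longrightarrow> xs = ys" for xs ys
  proof (induction xs arbitrary: ys)
    case Nil
    then show ?case by (cases ys) (auto split: if_splits)
  next
    case (Cons x xs)
    from Cons.prems obtain y zs where ys: "ys = y # zs"
      by (cases ys) (auto split: if_splits)
    have eq: "2 * bstring_code xs + (if x then 2 else 1) =
        2 * bstring_code zs + (if y then 2 else 1)"
      using Cons.prems ys by simp
    have "x = y"
      using eq by (cases x; cases y; simp; presburger)
    with eq Cons.IH[of zs] ys show ?case by simp
  qed
  then show "inj bstring_code" by (rule injI)
  have "\<exists>xs. bstring_code xs = n" for n
  proof (induction n rule: less_induct)
    case (less n)
    show ?case
    proof (cases "n = 0")
      case True
      then show ?thesis by (intro exI[of _ "[]"]) simp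
    next
      case False
      then have "(n - 1) div 2 < n" by linarith
      then obtain xs where xs: "bstring_code xs = (n - 1) div 2"
        using less.IH by blast
      have "bstring_code (even n # xs) = n"
        using False xs by (cases "even n") (auto elim!: evenE oddE)
      then show ?thesis by blast
    qed
  qed
  then show "surj bstring_code" by (metis surjI)
qed

text \<open>
  A programming language is a partial computable map from programs to outputs.
\<close>

definition computable_language :: "(bstring \<Rightarrow> bstring option) \<Rightarrow> bool" where
  "computable_language V \<longleftrightarrow>
     (\<exists>r. \<forall>q. recf_eval r [bstring_code q] = map_option bstring_code (V q))"

text \<open>The value is \<open>\<infinity>\<close> if no program produces \<open>x\<close>.\<close>

definition complexity :: "(bstring \<Rightarrow> bstring option) \<Rightarrow> bstring \<Rightarrow> enat" where
  "complexity V x = (INF q\<in>{q. V q = Some x}. enat (length q))"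

definition optimal_language :: "(bstring \<Rightarrow> bstring option) \<Rightarrow> bool" where
  "optimal_language U \<longleftrightarrow>
     computable_language U \<and>
     (\<forall>V. computable_language V \<longrightarrow>
        (\<exists>c::nat. \<forall>x. complexity U x \<le> complexity V x + enat c))"

text \<open>The convention \<open>0 log 0 = 0\<close> holds automatically.\<close>

definition binary_entropy :: "real \<Rightarrow> real" where
  "binary_entropy p = - p * log 2 p - (1 - p) * log 2 (1 - p)"

definition noisy_param :: "real \<Rightarrow> real \<Rightarrow> real" where
  "noisy_param p \<tau> = p * (1 - \<tau>) + (1 - p) * \<tau>"

text \<open>Component \<open>i\<close> of the i.i.d. vector \<open>e\<close> says whether bit \<open>i\<close> of \<open>x\<close> is flipped.\<close>

definition noise :: "real \<Rightarrow> bstring \<Rightarrow> bstring pmf" where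
  "noise \<tau> x = map_pmf (\<lambda>e. map2 (\<noteq>) x e) (replicate_pmf (length x) (bernoulli_pmf \<tau>))"

end

theory Submission
  imports Defs "HOL-Real_Asymp.Real_Asymp"
begin

text \<open>
  Suppose that noise turns \<open>x\<close> into a string of complexity below \<open>k = \<beta> n - g(n)\<close> with probability more
  than \<open>1/n\<close>. The strings \<open>x\<close> with this property form a set \<open>A\<close> that can be enumerated from \<open>n\<close>, \<open>k\<close>
  and a rational approximation of \<open>\<tau>\<close>, so \<open>C(x) \<le> log |A| + O(log n)\<close> and hence
  \<open>log |A| \<ge> \<alpha> n - O(log n)\<close>. Let \<open>X\<close> be uniform on \<open>A\<close>. Mrs. Gerber's lemma (convexity of
  \<open>H(N(p, \<tau>))\<close> as a function of \<open>H(p)\<close>, tensorised by the chain rule) gives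
  \<open>H(N\<^sub>\<tau>(X)) \<ge> \<beta> n - O(log n)\<close>. On the other hand, by concentration of measure, the
  \<open>O(sqrt (n log n))\<close>-neighbourhood of the fewer than \<open>2\<^sup>k\<close> strings of complexity below \<open>k\<close> carries
  \<open>N\<^sub>\<tau>(X)\<close> with probability at least \<open>1 - 1/n\<close>, and it has only \<open>2 powr (k + o(n))\<close> elements. So
  \<open>H(N\<^sub>\<tau>(X)) \<le> k + o(n)\<close>, which is a contradiction when \<open>g\<close> dominates the error terms; these do not
  depend on \<open>p\<close> and \<open>\<tau>\<close>, and \<open>g(n) = n powr (3/4)\<close> suffices.
\<close>

section \<open>Binary entropy under noise\<close>

text \<open>Two obstacles shape the proof. First, \<tau> may have no finite description, while A
  must be enumerable from few bits. So \<tau> is rounded down to j / n^2, and the enumeration and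
  the entropy estimates use this rounded level, which changes with n. For large n, depending on p
  and \<tau>, the rounding at most halves the probability of an output and moves n times the output
  entropy per bit by at most 1. Second, strings of small complexity can only be enumerated, so
  membership in A shows up at some stage of a simulation; this is why total stage-bounded simulators
  of recursive functions are built. Mrs. Gerber's lemma enters through supporting lines of H(N(q,
  \<tau>)) as a function of H(q), which avoids inverting H. Their slopes lie in [0, 1], so a deficit
  in the input entropy costs at most as much at the output, whatever p and \<tau> are; hence g is
  uniform. The dominant error is the logarithm of the size of a Hamming ball of radius O(sqrt (n log
  n)), at most of order sqrt n (log n)^(3/2). Any exponent strictly between 1/2 and 1 would
  therefore serve in g.\<close>

lemma continuous_on_x_ln_x: "continuous_on {0..} (\<lambda>x::real. x * ln x)"
proof -
  have "continuous (at x within {0..}) (\<lambda>x::real. x * ln x)" if "x \<ge> 0" for x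
  proof (cases "x = 0")
    case True
    have "((\<lambda>x::real. x * ln x) \<longlongrightarrow> 0) (at_right 0)" by real_asymp
    moreover have "at (0::real) within {0..} = at_right 0"
      by (rule at_within_nhd[of 0 UNIV]) auto
    ultimately show ?thesis using True by (simp add: continuous_within)
  next
    case False
    then show ?thesis using that by (intro continuous_intros) auto
  qed
  then show ?thesis by (auto simp: continuous_on_eq_continuous_within)
qed

text \<open>In terms of the bias a = 1 - 2 q, noise is multiplication by 1 - 2 \<tau> and the
  derivative of the entropy is - artanh a / ln 2. Convexity under noise thus becomes a statement
  about artanh.\<close>

definition bias_entropy :: "real \<Rightarrow> real" where
  "bias_entropy a = binary_entropy ((1 - a) / 2)"

lemma binary_entropy_ln: "binary_entropy p = (- (p * ln p) - (1 - p) * ln (1 - p)) / ln 2"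
proof -
  have "- p * log 2 p - (1 - p) * log 2 (1 - p) = - p * (ln p / ln 2) - (1 - p) * (ln (1 - p) / ln 2)"
    by (simp only: log_def)
  also have "\<dots> = (- (p * ln p) - (1 - p) * ln (1 - p)) / ln 2"
    by (simp only: diff_divide_distrib times_divide_eq_right mult_minus_left minus_divide_left)
  finally show ?thesis unfolding binary_entropy_def .
qed

lemma binary_entropy_flip: "binary_entropy (1 - p) = binary_entropy p"
  by (simp add: binary_entropy_def algebra_simps)

lemma continuous_on_binary_entropy: "continuous_on {0..1} binary_entropy"
proof -
  have a: "continuous_on {0..1} (\<lambda>x::real. x * ln x)"
    by (rule continuous_on_subset[OF continuous_on_x_ln_x]) auto
  have b: "continuous_on {0..1} (\<lambda>x::real. (1 - x) * ln (1 - x))"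
    by (rule continuous_on_compose2[OF continuous_on_x_ln_x]) (auto intro!: continuous_intros)
  show ?thesis
    unfolding binary_entropy_ln by (intro continuous_intros a b) auto
qed

lemma binary_entropy_has_real_derivative:
  assumes "0 < p" "p < 1"
  shows "(binary_entropy has_real_derivative (ln (1 - p) - ln p) / ln 2) (at p)"
proof -
  have "((\<lambda>p. (- (p * ln p) - (1 - p) * ln (1 - p)) / ln 2) has_real_derivative
      (ln (1 - p) - ln p) / ln 2) (at p)"
    using assms by (auto intro!: derivative_eq_intros)
  then show ?thesis by (simp add: binary_entropy_ln[abs_def])
qed

lemma bias_entropy_minus: "bias_entropy (- a) = bias_entropy a"
proof -
  have "(1 - - a) / 2 = 1 - (1 - a) / 2" by (simp add: field_simps)
  then show ?thesis unfolding bias_entropy_def by (metis binary_entropy_flip)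
qed

lemma continuous_on_bias_entropy: "continuous_on {-1..1} bias_entropy"
  unfolding bias_entropy_def[abs_def]
  by (rule continuous_on_compose2[OF continuous_on_binary_entropy]) (auto intro!: continuous_intros)

lemma bias_entropy_has_real_derivative:
  assumes "-1 < a" "a < 1"
  shows "(bias_entropy has_real_derivative - artanh a / ln 2) (at a)"
proof -
  have 1: "((\<lambda>a. (1 - a) / 2) has_real_derivative (- 1 / 2)) (at a)"
    by (auto intro!: derivative_eq_intros)
  have 2: "(ln (1 - (1 - a) / 2) - ln ((1 - a) / 2)) / ln 2 * (- 1 / 2) = - artanh a / ln 2"
  proof -
    have "ln (1 - (1 - a) / 2) - ln ((1 - a) / 2) = ln ((1 + a) / (1 - a))"
    proof -
      have 0: "1 - (1 - a) / 2 = (1 + a) / 2" by (simp add: field_simps)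
      have "ln ((1 + a) / 2) = ln (1 + a) - ln 2" "ln ((1 - a) / 2) = ln (1 - a) - ln 2"
        "ln ((1 + a) / (1 - a)) = ln (1 + a) - ln (1 - a)"
        using assms by (simp_all add: ln_div)
      then show ?thesis unfolding 0 by linarith
    qed
    then show ?thesis by (simp add: artanh_def)
  qed
  have "(binary_entropy has_real_derivative (ln (1 - (1 - a) / 2) - ln ((1 - a) / 2)) / ln 2)
      (at ((1 - a) / 2))"
    using assms by (intro binary_entropy_has_real_derivative) auto
  from DERIV_chain2[OF this 1] show ?thesis
    unfolding 2 by (simp add: bias_entropy_def[abs_def])
qed

lemma bias_entropy_antimono:
  assumes "0 \<le> a" "a \<le> b" "b \<le> 1"
  shows "bias_entropy b \<le> bias_entropy a"
proof (rule DERIV_nonpos_imp_decreasing_open[OF assms(2)])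
  fix x assume x: "a < x" "x < b"
  have "artanh x \<ge> 0"
    using x assms by (simp add: artanh_def)
  then show "\<exists>y. (bias_entropy has_real_derivative y) (at x) \<and> y \<le> 0"
    using x assms by (intro exI[of _ "- artanh x / ln 2"] conjI bias_entropy_has_real_derivative) auto
next
  show "continuous_on {a..b} bias_entropy"
    using assms by (intro continuous_on_subset[OF continuous_on_bias_entropy]) auto
qed

section \<open>Monotonicity of quotients of artanh\<close>

lemma artanh_mono: "0 \<le> a \<Longrightarrow> a \<le> b \<Longrightarrow> b < 1 \<Longrightarrow> artanh a \<le> artanh (b::real)"
  unfolding artanh_def by (auto intro!: divide_right_mono frac_le)

lemma artanh_pos: "0 < a \<Longrightarrow> a < 1 \<Longrightarrow> 0 < artanh (a::real)"
  by (auto simp: artanh_def)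

lemma artanh_ge_self:
  assumes "0 \<le> a" "a < (1::real)"
  shows "a \<le> artanh a"
proof -
  have "artanh 0 - 0 \<le> artanh a - a"
  proof (rule DERIV_nonneg_imp_nondecreasing[OF assms(1)])
    fix x assume x: "0 \<le> x" "x \<le> a"
    then have "x\<^sup>2 < 1" using assms by (simp add: abs_square_less_1)
    then have "1 / (1 - x\<^sup>2) - 1 \<ge> 0" by (simp add: field_simps)
    then show "\<exists>y. ((\<lambda>a. artanh a - a) has_real_derivative y) (at x) \<and> 0 \<le> y"
      using x assms by (intro exI[of _ "1 / (1 - x\<^sup>2) - 1"]) (auto intro!: derivative_eq_intros)
  qed
  then show ?thesis by simp
qed

text \<open>The quotient is the reciprocal of the elasticity x artanh'(x) / artanh x; comparing
  elasticities at \<open>c * x\<close> and \<open>x\<close> gives the sign of the derivative of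
  artanh (c x) / artanh x. The numerator of its own derivative is x - (1 + x^2) artanh x, which is
  nonpositive because artanh x >= x.\<close>

lemma artanh_quotient_antimono:
  assumes "0 < x" "x \<le> y" "y < (1::real)"
  shows "(1 - y\<^sup>2) * artanh y / y \<le> (1 - x\<^sup>2) * artanh x / x"
proof (rule DERIV_nonpos_imp_nonincreasing[OF assms(2)])
  fix z assume z: "x \<le> z" "z \<le> y"
  have z1: "0 < z" "z < 1" using z assms by auto
  then have z2: "z\<^sup>2 < 1" by (simp add: abs_square_less_1)
  have "((\<lambda>x. (1 - x\<^sup>2) * artanh x / x) has_real_derivative
      (((- (2 * z)) * artanh z + 1 / (1 - z\<^sup>2) * (1 - z\<^sup>2)) * z - (1 - z\<^sup>2) * artanh z * 1) / (z * z)) (at z)"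
    using z1 z2 by (auto intro!: derivative_eq_intros)
  moreover have "(((- (2 * z)) * artanh z + 1 / (1 - z\<^sup>2) * (1 - z\<^sup>2)) * z - (1 - z\<^sup>2) * artanh z * 1) / (z * z)
      = (z - (1 + z\<^sup>2) * artanh z) / z\<^sup>2"
    using z2 by (simp add: algebra_simps power2_eq_square)
  ultimately have "((\<lambda>x. (1 - x\<^sup>2) * artanh x / x) has_real_derivative
      (z - (1 + z\<^sup>2) * artanh z) / z\<^sup>2) (at z)" by simp
  moreover have "z - (1 + z\<^sup>2) * artanh z \<le> 0"
  proof -
    have "1 * artanh z \<le> (1 + z\<^sup>2) * artanh z"
      using artanh_pos[OF z1] by (intro mult_right_mono) auto
    then show ?thesis using artanh_ge_self[of z] z1 by linarith
  qed
  ultimately show "\<exists>w. ((\<lambda>x. (1 - x\<^sup>2) * artanh x / x) has_real_derivative w) (at z) \<and> w \<le> 0"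
    by (meson divide_nonpos_nonneg zero_le_power2)
qed

text \<open>With c = |1 - 2 \<tau>|, the slope of H(N(q, \<tau>)) against H(q) at bias x is c times
  artanh (c x) / artanh x. It falls as the bias grows, that is, it rises with the entropy: this is
  the convexity behind Mrs. Gerber's lemma.\<close>

lemma artanh_ratio_antimono:
  assumes "0 \<le> c" "c \<le> 1" "0 < a" "a \<le> b" "b < (1::real)"
  shows "artanh (c * b) / artanh b \<le> artanh (c * a) / artanh a"
proof (cases "c = 0")
  case False
  then have c: "0 < c" using assms by simp
  show ?thesis
  proof (rule DERIV_nonpos_imp_nonincreasing[OF assms(4), where f = "\<lambda>x. artanh (c * x) / artanh x"])
    fix z assume z: "a \<le> z" "z \<le> b"
    have z1: "0 < z" "z < 1" using z assms by auto
    have cz: "0 < c * z" "c * z \<le> z"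
      using z1 c assms by (auto intro: mult_left_le_one_le)
    then have "c * z < 1" using z1 by linarith
    note cz = cz this
    have z2: "z\<^sup>2 < 1" "(c * z)\<^sup>2 < 1" using z1 cz by (auto simp: abs_square_less_1)
    let ?D = "(c / (1 - (c * z)\<^sup>2) * artanh z - artanh (c * z) / (1 - z\<^sup>2)) / (artanh z)\<^sup>2"
    have num: "((\<lambda>x. artanh (c * x)) has_real_derivative 1 / (1 - (c * z)\<^sup>2) * c) (at z)"
    proof -
      have "(artanh has_real_derivative 1 / (1 - (c * z)\<^sup>2)) (at (c * z))"
        using cz by (intro artanh_real_has_field_derivative) auto
      moreover have "((\<lambda>x. c * x) has_real_derivative c) (at z)" by (auto intro!: derivative_eq_intros)
      ultimately show ?thesis by (rule DERIV_chain2)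
    qed
    have den: "(artanh has_real_derivative 1 / (1 - z\<^sup>2)) (at z)"
      using z1 by (intro artanh_real_has_field_derivative) auto
    have "((\<lambda>x. artanh (c * x) / artanh x) has_real_derivative ?D) (at z)"
      using DERIV_divide[OF num den] artanh_pos[OF z1] by (simp add: power2_eq_square mult_ac)
    moreover have "c / (1 - (c * z)\<^sup>2) * artanh z - artanh (c * z) / (1 - z\<^sup>2) \<le> 0"
    proof -
      have "(1 - z\<^sup>2) * artanh z / z \<le> (1 - (c * z)\<^sup>2) * artanh (c * z) / (c * z)"
        using z1 cz by (intro artanh_quotient_antimono) auto
      then have "c * ((1 - z\<^sup>2) * artanh z) \<le> (1 - (c * z)\<^sup>2) * artanh (c * z)"
      proof -
        have "(1 - z\<^sup>2) * artanh z / z * (c * z) \<le> (1 - (c * z)\<^sup>2) * artanh (c * z) / (c * z) * (c * z)"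
          using cz \<open>_ \<le> _ / (c * z)\<close> by (intro mult_right_mono) auto
        moreover have "(1 - z\<^sup>2) * artanh z / z * (c * z) = c * ((1 - z\<^sup>2) * artanh z)"
          using z1 by simp
        moreover have "(1 - (c * z)\<^sup>2) * artanh (c * z) / (c * z) * (c * z) = (1 - (c * z)\<^sup>2) * artanh (c * z)"
          using z1 c by simp
        ultimately show ?thesis by linarith
      qed
      then show ?thesis using z2 by (simp add: divide_simps mult_ac)
    qed
    ultimately show "\<exists>w. ((\<lambda>x. artanh (c * x) / artanh x) has_real_derivative w) (at z) \<and> w \<le> 0"
      by (meson divide_nonpos_nonneg zero_le_power2)
  qed
qed simp

text \<open>The supporting line at \<open>a\<close>, obtained by minimising a difference: by the
  monotone ratio its derivative is nonpositive left of \<open>a\<close> and nonnegative right of it.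
  Only interior points are differentiated, as artanh blows up at 1 and the ratio is 0 / 0 at 0;
  continuity covers the ends.\<close>

lemma bias_entropy_tangent:
  assumes c: "0 \<le> c" "c \<le> 1" and a: "0 < a" "a < 1" and b: "0 \<le> b" "b \<le> 1"
  defines "s \<equiv> c * (artanh (c * a) / artanh a)"
  shows "bias_entropy (c * a) - s * bias_entropy a \<le> bias_entropy (c * b) - s * bias_entropy b"
proof -
  let ?f = "\<lambda>x. bias_entropy (c * x) - s * bias_entropy x"
  have der: "(?f has_real_derivative
      artanh x / ln 2 * (s - c * (artanh (c * x) / artanh x))) (at x)" if x: "0 < x" "x < 1" for x
  proof -
    have "0 \<le> c * x" "c * x \<le> x" using x c by (auto intro: mult_left_le_one_le)
    then have cx: "-1 < c * x" "c * x < 1" using x by linarith+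
    have "((\<lambda>x. c * x) has_real_derivative c) (at x)" by (auto intro!: derivative_eq_intros)
    from DERIV_chain2[OF bias_entropy_has_real_derivative[OF cx] this]
    have "((\<lambda>x. bias_entropy (c * x)) has_real_derivative - artanh (c * x) / ln 2 * c) (at x)" .
    from DERIV_diff[OF this DERIV_cmult[OF bias_entropy_has_real_derivative, of x s]]
    moreover have "- artanh (c * x) / ln 2 * c - s * (- artanh x / ln 2) =
        artanh x / ln 2 * (s - c * (artanh (c * x) / artanh x))"
      using artanh_pos[OF x] by (simp add: field_simps)
    ultimately show ?thesis using x by simp
  qed
  have cont: "continuous_on {u..v} ?f" if "0 \<le> u" "v \<le> 1" for u v
  proof -
    have "continuous_on {u..v} (\<lambda>x. bias_entropy (c * x))"
    proof (rule continuous_on_compose2[OF continuous_on_bias_entropy, of "{u..v}" "\<lambda>x. c * x"])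
      show "(\<lambda>x. c * x) ` {u..v} \<subseteq> {-1..1}"
      proof (rule image_subsetI)
        fix z assume "z \<in> {u..v}"
        then have "0 \<le> c * z" "c * z \<le> 1" using that c by (auto intro: mult_le_one)
        then show "c * z \<in> {-1..1}" by auto
      qed
    qed (intro continuous_intros)
    moreover have "continuous_on {u..v} bias_entropy"
      using that by (intro continuous_on_subset[OF continuous_on_bias_entropy]) auto
    ultimately show ?thesis by (intro continuous_intros)
  qed
  show ?thesis
  proof (cases "b \<le> a")
    case True
    show ?thesis
    proof (rule DERIV_nonpos_imp_decreasing_open[OF True])
      fix x assume x: "b < x" "x < a"
      then have x1: "0 < x" "x < 1" using a b by auto
      have "artanh (c * a) / artanh a \<le> artanh (c * x) / artanh x"
        using x x1 a c by (intro artanh_ratio_antimono) auto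
      then have "s - c * (artanh (c * x) / artanh x) \<le> 0"
        unfolding s_def using mult_left_mono[OF _ c(1)] by fastforce
      then have "artanh x / ln 2 * (s - c * (artanh (c * x) / artanh x)) \<le> 0"
        using artanh_pos[OF x1] by (intro mult_nonneg_nonpos) auto
      then show "\<exists>y. (?f has_real_derivative y) (at x) \<and> y \<le> 0" using der[OF x1] by blast
    qed (use cont a b in auto)
  next
    case False
    then have ab: "a \<le> b" by simp
    show ?thesis
    proof (rule DERIV_nonneg_imp_increasing_open[OF ab])
      fix x assume x: "a < x" "x < b"
      then have x1: "0 < x" "x < 1" using a b by auto
      have "artanh (c * x) / artanh x \<le> artanh (c * a) / artanh a"
        using x x1 a c by (intro artanh_ratio_antimono) auto
      then have "s - c * (artanh (c * x) / artanh x) \<ge> 0"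
        unfolding s_def using mult_left_mono[OF _ c(1)] by fastforce
      then have "artanh x / ln 2 * (s - c * (artanh (c * x) / artanh x)) \<ge> 0"
        using artanh_pos[OF x1] by (intro mult_nonneg_nonneg) auto
      then show "\<exists>y. (?f has_real_derivative y) (at x) \<and> y \<ge> 0" using der[OF x1] by blast
    qed (use cont a b in auto)
  qed
qed

lemma bias_entropy_abs: "bias_entropy \<bar>a\<bar> = bias_entropy a"
  by (simp add: abs_if bias_entropy_minus)

lemma binary_entropy_bias: "binary_entropy q = bias_entropy (1 - 2 * q)"
  by (simp add: bias_entropy_def)

lemma noisy_param_bias: "1 - 2 * noisy_param q \<tau> = (1 - 2 * \<tau>) * (1 - 2 * q)"
  by (simp add: noisy_param_def algebra_simps)

text \<open>Entropy is even in the bias, so absolute values reduce everything to nonnegative biases.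
  The bound s <= 1 is what later keeps the error terms independent of p and \<tau>.\<close>

lemma binary_entropy_noisy_tangent:
  assumes p: "0 \<le> p" "p \<le> 1 / 2" and \<tau>: "0 \<le> \<tau>" "\<tau> \<le> 1"
  obtains s where "0 \<le> s" "s \<le> 1"
    "\<And>q. 0 \<le> q \<Longrightarrow> q \<le> 1 \<Longrightarrow>
      binary_entropy (noisy_param p \<tau>) + s * (binary_entropy q - binary_entropy p)
        \<le> binary_entropy (noisy_param q \<tau>)"
proof -
  define c where "c = \<bar>1 - 2 * \<tau>\<bar>"
  define a where "a = 1 - 2 * p"
  have c: "0 \<le> c" "c \<le> 1" using \<tau> by (auto simp: c_def)
  have a: "0 \<le> a" "a \<le> 1" using p by (auto simp: a_def)
  have N: "binary_entropy (noisy_param q \<tau>) = bias_entropy (c * \<bar>1 - 2 * q\<bar>)" for q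
    by (metis abs_mult bias_entropy_abs binary_entropy_bias c_def noisy_param_bias)
  have E: "binary_entropy q = bias_entropy \<bar>1 - 2 * q\<bar>" for q
    by (metis bias_entropy_abs binary_entropy_bias)
  have "\<exists>s. 0 \<le> s \<and> s \<le> 1 \<and> (\<forall>b. 0 \<le> b \<longrightarrow> b \<le> 1 \<longrightarrow>
      bias_entropy (c * a) + s * (bias_entropy b - bias_entropy a) \<le> bias_entropy (c * b))"
  proof -
    \<comment> \<open>The formula for the slope degenerates at both ends. For p = 1/2 slope 1 works
      because noise does not decrease entropy; for p = 0 slope 0 works because a constant bit has
      the least output entropy.\<close>
    consider "a = 0" | "a = 1" | "0 < a" "a < 1" using a by linarith
    then show ?thesis
    proof cases
      case 1
      then show ?thesis using c
        by (intro exI[of _ 1]) (auto intro!: bias_entropy_antimono mult_left_le_one_le)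
    next
      case 2
      then show ?thesis using c
        by (intro exI[of _ 0]) (auto intro!: bias_entropy_antimono mult_left_le)
    next
      case 3
      have ca: "0 \<le> c * a" "c * a \<le> a" using c 3 by (auto simp: mult_left_le_one_le)
      have "artanh (c * a) \<ge> 0" "artanh (c * a) \<le> artanh a"
        using artanh_mono[of 0 "c * a"] artanh_mono[of "c * a" a] ca 3 by auto
      then have r: "0 \<le> artanh (c * a) / artanh a" "artanh (c * a) / artanh a \<le> 1"
        using artanh_pos[of a] 3 by (auto simp: divide_le_eq_1)
      define s where "s = c * (artanh (c * a) / artanh a)"
      have "0 \<le> s" "s \<le> 1" unfolding s_def using c r by (blast intro: mult_le_one mult_nonneg_nonneg)+
      moreover have "bias_entropy (c * a) + s * (bias_entropy b - bias_entropy a) \<le> bias_entropy (c * b)"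
        if "0 \<le> b" "b \<le> 1" for b
        using bias_entropy_tangent[OF c 3 that, folded s_def] by (simp add: algebra_simps)
      ultimately show ?thesis by blast
    qed
  qed
  then obtain s where s: "0 \<le> s" "s \<le> 1" "\<And>b. 0 \<le> b \<Longrightarrow> b \<le> 1 \<Longrightarrow>
      bias_entropy (c * a) + s * (bias_entropy b - bias_entropy a) \<le> bias_entropy (c * b)"
    by blast
  have "binary_entropy (noisy_param p \<tau>) + s * (binary_entropy q - binary_entropy p)
        \<le> binary_entropy (noisy_param q \<tau>)" if "0 \<le> q" "q \<le> 1" for q
  proof -
    have "\<bar>1 - 2 * p\<bar> = a" using p by (simp add: a_def)
    moreover have "0 \<le> \<bar>1 - 2 * q\<bar>" "\<bar>1 - 2 * q\<bar> \<le> 1" using that by auto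
    ultimately show ?thesis using s(3)[of "\<bar>1 - 2 * q\<bar>"] by (simp only: N E[of p] E[of q])
  qed
  then show thesis using that s by blast
qed

lemma binary_entropy_le_1:
  assumes "0 \<le> q" "q \<le> 1"
  shows "binary_entropy q \<le> 1"
proof -
  have "bias_entropy \<bar>1 - 2 * q\<bar> \<le> bias_entropy 0"
    using assms by (intro bias_entropy_antimono) auto
  moreover have "bias_entropy 0 = 1" by (simp add: bias_entropy_def binary_entropy_def log_divide)
  ultimately show ?thesis by (simp add: bias_entropy_abs binary_entropy_bias)
qed

text \<open>At an interior point the difference quotients of H are bounded by some C, so after
  multiplication by n the error is at most C / n. For n = 0 the hypothesis reads
  \<open>w 0 = q\<close>, since 1 / 0 = 0.\<close>

lemma binary_entropy_approx:
  assumes q: "0 < q" "q < 1" and w: "\<And>n. \<bar>w n - q\<bar> \<le> 1 / (real n)\<^sup>2"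
  shows "\<forall>\<^sub>F n in sequentially. \<bar>binary_entropy (w n) - binary_entropy q\<bar> * real n \<le> 1"
proof -
  let ?D = "(ln (1 - q) - ln q) / ln 2"
  define C where "C = \<bar>?D\<bar> + 1"
  have C: "0 < C" unfolding C_def by (intro add_nonneg_pos) auto
  have "((\<lambda>z. (binary_entropy z - binary_entropy q) / (z - q)) \<longlongrightarrow> ?D) (at q)"
    using binary_entropy_has_real_derivative[OF q] by (simp add: has_field_derivative_iff)
  then have "((\<lambda>z. \<bar>(binary_entropy z - binary_entropy q) / (z - q)\<bar>) \<longlongrightarrow> \<bar>?D\<bar>) (at q)"
    by (rule tendsto_rabs)
  then have "\<forall>\<^sub>F z in at q. \<bar>(binary_entropy z - binary_entropy q) / (z - q)\<bar> < C"
    by (rule order_tendstoD) (simp add: C_def)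
  then have "\<forall>\<^sub>F z in nhds q. z \<noteq> q \<longrightarrow> \<bar>(binary_entropy z - binary_entropy q) / (z - q)\<bar> < C"
    by (simp add: eventually_at_filter)
  moreover have "filterlim w (nhds q) sequentially"
  proof -
    have "(\<lambda>n. 1 / (real n)\<^sup>2) \<longlonglongrightarrow> 0" by real_asymp
    then have "(\<lambda>n. w n - q) \<longlonglongrightarrow> 0"
      by (rule Lim_null_comparison[rotated]) (simp add: w)
    then show ?thesis by (simp add: LIM_zero_iff)
  qed
  ultimately have "\<forall>\<^sub>F n in sequentially. w n \<noteq> q \<longrightarrow>
      \<bar>(binary_entropy (w n) - binary_entropy q) / (w n - q)\<bar> < C"
    by (rule eventually_compose_filterlim)
  moreover have "\<forall>\<^sub>F n in sequentially. max 1 C \<le> real n"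
    using filterlim_real_sequentially unfolding filterlim_at_top by blast
  ultimately show ?thesis
  proof eventually_elim
    case (elim n)
    have "\<bar>binary_entropy (w n) - binary_entropy q\<bar> \<le> C * \<bar>w n - q\<bar>"
      using elim(1) by (cases "w n = q") (auto simp: abs_divide divide_less_eq)
    also have "\<dots> \<le> C * (1 / (real n)\<^sup>2)" using w C by (intro mult_left_mono) auto
    finally have "\<bar>binary_entropy (w n) - binary_entropy q\<bar> * real n \<le> C * (1 / (real n)\<^sup>2) * real n"
      by (intro mult_right_mono) auto
    also have "\<dots> = C / real n" using elim(2) by (simp add: power2_eq_square)
    also have "\<dots> \<le> 1" using elim(2) by simp
    finally show ?case .
  qed
qed

section \<open>Mrs. Gerber's lemma for words\<close>

definition words :: "nat \<Rightarrow> bstring set" where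
  "words n = {x. length x = n}"

lemma finite_words [simp]: "finite (words n)"
  using finite_lists_length_eq[of "UNIV :: bool set" n] by (simp add: words_def)

lemma words_0 [simp]: "words 0 = {[]}"
  by (auto simp: words_def)

lemma card_words: "card (words n) = 2 ^ n"
  using card_lists_length_eq[of "UNIV :: bool set" n] by (simp add: words_def)

lemma sum_words_Suc:
  "(\<Sum>x\<in>words (Suc n). f x) = (\<Sum>x\<in>words n. f (True # x) + f (False # x))"
proof -
  have w: "words (Suc n) = (#) True ` words n \<union> (#) False ` words n"
    by (auto simp: words_def length_Suc_conv)
  show ?thesis
    unfolding w by (subst sum.union_disjoint) (auto simp: sum.reindex sum.distrib)
qed

text \<open>The channel matrix of \<open>noise\<close> (see \<open>pmf_noise\<close>). Entropy and
  concentration are proved for finite sums over it, and the probability measure enters only at the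
  end.\<close>

fun flip_prob :: "real \<Rightarrow> bstring \<Rightarrow> bstring \<Rightarrow> real" where
  "flip_prob \<tau> [] [] = 1"
| "flip_prob \<tau> (a # x) (b # y) = (if a = b then 1 - \<tau> else \<tau>) * flip_prob \<tau> x y"
| "flip_prob \<tau> _ _ = 0"

lemma flip_prob_nonneg: "0 \<le> \<tau> \<Longrightarrow> \<tau> \<le> 1 \<Longrightarrow> 0 \<le> flip_prob \<tau> x y"
  by (induction \<tau> x y rule: flip_prob.induct) auto

lemma sum_flip_prob: "x \<in> words n \<Longrightarrow> (\<Sum>y\<in>words n. flip_prob \<tau> x y) = 1"
proof (induction n arbitrary: x)
  case (Suc n)
  then obtain a x' where x: "x = a # x'" "x' \<in> words n" by (auto simp: words_def length_Suc_conv)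
  have "(\<Sum>y\<in>words (Suc n). flip_prob \<tau> x y) = (\<Sum>y\<in>words n. flip_prob \<tau> x' y)"
    unfolding sum_words_Suc by (rule sum.cong) (auto simp: x algebra_simps)
  then show ?case using Suc.IH x by simp
qed simp

section \<open>Unnormalised entropy of a split mass\<close>

definition plog :: "real \<Rightarrow> real" where
  "plog x = - (x * log 2 x)"

text \<open>For a + b > 0 this is (a + b) H(b / (a + b)), the entropy of a bit weighted by the mass
  it occurs with. It is homogeneous, so no conditional probabilities have to be formed.\<close>

definition split_entropy :: "real \<Rightarrow> real \<Rightarrow> real" where
  "split_entropy a b = plog a + plog b - plog (a + b)"

lemma plog_0 [simp]: "plog 0 = 0" by (simp add: plog_def)

lemma split_entropy_0 [simp]: "split_entropy 0 0 = 0" by (simp add: split_entropy_def)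

lemma split_entropy_homogeneous:
  assumes "0 \<le> m" "0 \<le> a" "0 \<le> b"
  shows "split_entropy (m * a) (m * b) = m * split_entropy a b"
proof (cases "m = 0")
  case False
  then have m: "0 < m" using assms by simp
  have P: "plog (m * x) = m * plog x - m * x * log 2 m" if "0 \<le> x" for x
    using m that by (cases "x = 0") (auto simp: plog_def log_mult algebra_simps)
  have "split_entropy (m * a) (m * b) = plog (m * a) + plog (m * b) - plog (m * (a + b))"
    by (simp add: split_entropy_def algebra_simps)
  then show ?thesis using P[of a] P[of b] P[of "a + b"] assms
    by (simp add: split_entropy_def algebra_simps)
qed simp

lemma split_entropy_binary:
  assumes "0 \<le> m" "0 \<le> q" "q \<le> 1"
  shows "split_entropy (m * (1 - q)) (m * q) = m * binary_entropy q"
  using split_entropy_homogeneous[OF assms(1), of "1 - q" q] assms(2,3)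
  by (simp add: split_entropy_def binary_entropy_def plog_def)

lemma log_sum_inequality2:
  assumes "0 \<le> a" "0 \<le> b" "0 \<le> a'" "0 \<le> b'"
    and "b = 0 \<Longrightarrow> a = 0" "b' = 0 \<Longrightarrow> a' = 0"
  shows "(a + a') * log 2 ((a + a') / (b + b')) \<le> a * log 2 (a / b) + a' * log 2 (a' / b')"
proof -
  \<comment> \<open>The inequality ln u <= u - 1 at u = y t / x. With t the ratio of the two sums,
    the correction terms cancel.\<close>
  have key: "x * log 2 (x / y) \<ge> x * log 2 t + (x - y * t) / ln 2"
    if "0 \<le> x" "0 \<le> y" "y = 0 \<Longrightarrow> x = 0" "0 < t" for x y t
  proof (cases "x = 0")
    case True
    then show ?thesis using that by (simp add: field_simps)
  next
    case False
    then have xy: "0 < x" "0 < y" using that by force+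
    have "ln (y * t / x) \<le> y * t / x - 1" using xy that by (intro ln_le_minus_one) auto
    then have "x * ln (y * t / x) \<le> y * t - x"
      using xy by (simp add: field_simps)
    moreover have "ln (y * t / x) = ln t - ln (x / y)"
      using xy that by (simp add: ln_div ln_mult)
    then have "x * ln (y * t / x) = x * ln t - x * ln (x / y)"
      by (simp only: right_diff_distrib)
    ultimately have "x * ln t + (x - y * t) \<le> x * ln (x / y)" by linarith
    then show ?thesis by (simp add: log_def divide_right_mono add_divide_distrib[symmetric])
  qed
  show ?thesis
  proof (cases "a + a' = 0")
    case True
    then have "a = 0" "a' = 0" using assms by auto
    then show ?thesis by simp
  next
    case False
    then have pos: "0 < a + a'" "0 < b + b'" using assms by (smt (verit))+
    let ?t = "(a + a') / (b + b')"
    have t: "0 < ?t" using pos by simp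
    have "a * log 2 ?t + (a - b * ?t) / ln 2 + (a' * log 2 ?t + (a' - b' * ?t) / ln 2)
       \<le> a * log 2 (a / b) + a' * log 2 (a' / b')"
      using assms t by (intro add_mono key) auto
    moreover have "(a - b * ?t) / ln 2 + (a' - b' * ?t) / ln 2 = 0"
    proof -
      have "(b + b') * ?t = a + a'" using pos by simp
      then show ?thesis by (simp add: add_divide_distrib[symmetric] algebra_simps)
    qed
    ultimately show ?thesis by (simp add: algebra_simps)
  qed
qed

lemma split_entropy_log:
  assumes "0 \<le> a" "0 \<le> b"
  shows "split_entropy a b = - (a * log 2 (a / (a + b))) - b * log 2 (b / (a + b))"
proof -
  have *: "x * log 2 (x / (a + b)) = x * log 2 x - x * log 2 (a + b)" if "0 \<le> x" "x \<le> a + b" for x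
    using that by (cases "x = 0") (auto simp: log_divide algebra_simps)
  show ?thesis using assms by (simp add: * split_entropy_def plog_def algebra_simps)
qed

text \<open>Concavity of H in homogeneous form: merging two branches forgets which one occurred, and
  this can only make the bit less certain.\<close>

lemma split_entropy_superadditive:
  assumes "0 \<le> a" "0 \<le> b" "0 \<le> a'" "0 \<le> b'"
  shows "split_entropy a b + split_entropy a' b' \<le> split_entropy (a + a') (b + b')"
proof -
  have "(a + a') * log 2 ((a + a') / ((a + b) + (a' + b')))
      \<le> a * log 2 (a / (a + b)) + a' * log 2 (a' / (a' + b'))"
    using assms by (intro log_sum_inequality2) auto
  moreover have "(b + b') * log 2 ((b + b') / ((a + b) + (a' + b')))
      \<le> b * log 2 (b / (a + b)) + b' * log 2 (b' / (a' + b'))"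
    using assms by (intro log_sum_inequality2) auto
  ultimately show ?thesis
    using assms by (simp add: split_entropy_log add_ac)
qed

lemma split_entropy_sum:
  assumes "\<And>i. i \<in> I \<Longrightarrow> 0 \<le> a i" "\<And>i. i \<in> I \<Longrightarrow> 0 \<le> b i"
  shows "(\<Sum>i\<in>I. split_entropy (a i) (b i)) \<le> split_entropy (\<Sum>i\<in>I. a i) (\<Sum>i\<in>I. b i)"
  using assms
proof (induction I rule: infinite_finite_induct)
  case (insert i I)
  have "split_entropy (a i) (b i) + split_entropy (sum a I) (sum b I) \<le>
      split_entropy (a i + sum a I) (b i + sum b I)"
    using insert.prems by (intro split_entropy_superadditive sum_nonneg) auto
  then show ?case using insert by (auto intro: order_trans[rotated])
qed auto

definition word_entropy :: "nat \<Rightarrow> (bstring \<Rightarrow> real) \<Rightarrow> real" where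
  "word_entropy n P = (\<Sum>x\<in>words n. plog (P x))"

definition noisy :: "real \<Rightarrow> nat \<Rightarrow> (bstring \<Rightarrow> real) \<Rightarrow> bstring \<Rightarrow> real" where
  "noisy \<tau> n P y = (\<Sum>x\<in>words n. P x * flip_prob \<tau> x y)"

text \<open>The chain rule: entropy of the tail plus entropy of the first bit given the
  tail.\<close>

lemma word_entropy_Suc:
  "word_entropy (Suc n) P = word_entropy n (\<lambda>x. P (True # x) + P (False # x)) +
     (\<Sum>x\<in>words n. split_entropy (P (True # x)) (P (False # x)))"
  unfolding word_entropy_def sum_words_Suc split_entropy_def
  by (simp flip: sum.distrib)

lemma noisy_Suc:
  "noisy \<tau> (Suc n) P (b # y) =
     (\<Sum>x\<in>words n. flip_prob \<tau> x y * ((1 - \<tau>) * P (b # x) + \<tau> * P ((\<not> b) # x)))"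
  unfolding noisy_def sum_words_Suc by (cases b; simp) (auto intro!: sum.cong simp: algebra_simps)

text \<open>
  Given the tail of the input, the first output bit is independent of the tail of the output, so
  conditioning on the latter leaves at least as much entropy (superadditivity of
  \<^const>\<open>split_entropy\<close>). The \<^const>\<open>plog\<close> term vanishes for a probability distribution; it makes
  the base case hold for every total mass.
\<close>

lemma word_entropy_noisy_ge:
  assumes \<tau>: "0 \<le> \<tau>" "\<tau> \<le> 1"
    and tangent: "\<And>q. 0 \<le> q \<Longrightarrow> q \<le> 1 \<Longrightarrow>
      \<beta> + s * (binary_entropy q - \<alpha>) \<le> binary_entropy (noisy_param q \<tau>)"
    and P: "\<And>x. 0 \<le> P x"
  shows "word_entropy n (noisy \<tau> n P) \<ge>
    s * word_entropy n P + (\<Sum>x\<in>words n. P x) * (real n * (\<beta> - s * \<alpha>)) +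
    (1 - s) * plog (\<Sum>x\<in>words n. P x)"
  using P
proof (induction n arbitrary: P)
  case 0
  then show ?case by (simp add: word_entropy_def noisy_def algebra_simps)
next
  case (Suc n)
  define P' where "P' = (\<lambda>x. P (True # x) + P (False # x))"
  define R where "R = (\<lambda>b x. (1 - \<tau>) * P (b # x) + \<tau> * P ((\<not> b) # x))"
  have R0: "0 \<le> R b x" for b x using Suc.prems \<tau> by (auto simp: R_def)
  have Q: "noisy \<tau> (Suc n) P (b # y) = (\<Sum>x\<in>words n. flip_prob \<tau> x y * R b x)" for b y
    by (simp add: noisy_Suc R_def)
  have Q': "noisy \<tau> (Suc n) P (True # y) + noisy \<tau> (Suc n) P (False # y) = noisy \<tau> n P' y" for y
    unfolding Q unfolding noisy_def P'_def R_def by (simp flip: sum.distrib add: algebra_simps)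
  \<comment> \<open>The scalar inequality for the first bit given the tail \<open>x\<close>,
    weighted by the mass of that tail.\<close>
  have single: "P' x * (\<beta> - s * \<alpha>) + s * split_entropy (P (True # x)) (P (False # x))
      \<le> split_entropy (R True x) (R False x)" for x
  proof -
    define m where "m = P' x"
    \<comment> \<open>If the mass is zero, so are both of its parts, and any q in [0, 1] would
      represent them.\<close>
    define q where "q = (if m = 0 then 0 else P (False # x) / m)"
    have m0: "0 \<le> m" using Suc.prems by (simp add: m_def P'_def)
    have F1: "P (False # x) = m * q"
      using Suc.prems[of "True # x"] Suc.prems[of "False # x"]
      by (auto simp: q_def m_def P'_def)
    have "m = P (True # x) + P (False # x)" by (simp add: m_def P'_def)
    then have F: "P (False # x) = m * q" "P (True # x) = m * (1 - q)"
      using F1 by (auto simp: algebra_simps)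
    have q: "0 \<le> q" "q \<le> 1"
      using Suc.prems[of "True # x"] Suc.prems[of "False # x"] m0
      by (auto simp: q_def m_def P'_def divide_le_eq_1)
    have RF: "R False x = m * noisy_param q \<tau>" "R True x = m * (1 - noisy_param q \<tau>)"
      by (auto simp: R_def F noisy_param_def algebra_simps)
    have N: "0 \<le> noisy_param q \<tau>" "noisy_param q \<tau> \<le> 1"
    proof -
      show "0 \<le> noisy_param q \<tau>" using q \<tau> by (simp add: noisy_param_def)
      have "1 - noisy_param q \<tau> = q * \<tau> + (1 - q) * (1 - \<tau>)" by (simp add: noisy_param_def algebra_simps)
      moreover have "0 \<le> q * \<tau> + (1 - q) * (1 - \<tau>)" using q \<tau> by simp
      ultimately show "noisy_param q \<tau> \<le> 1" by simp
    qed
    have "m * (\<beta> + s * (binary_entropy q - \<alpha>)) \<le> m * binary_entropy (noisy_param q \<tau>)"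
      using tangent[OF q] m0 by (rule mult_left_mono)
    then show ?thesis
      unfolding F RF split_entropy_binary[OF m0 q] split_entropy_binary[OF m0 N] m_def[symmetric]
      by (simp add: algebra_simps)
  qed
  have "(\<Sum>x\<in>words n. P' x * (\<beta> - s * \<alpha>) + s * split_entropy (P (True # x)) (P (False # x)))
      \<le> (\<Sum>x\<in>words n. split_entropy (R True x) (R False x))"
    by (intro sum_mono single)
  \<comment> \<open>Transition probabilities summing to 1 bring in the output tail \<open>y\<close>.
    By homogeneity they move inside the entropy, and superadditivity then merges all input tails
    that lead to the same \<open>y\<close>.\<close>
  also have "\<dots> = (\<Sum>x\<in>words n. \<Sum>y\<in>words n. flip_prob \<tau> x y * split_entropy (R True x) (R False x))"
    by (rule sum.cong) (auto simp: sum_flip_prob simp flip: sum_distrib_right)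
  also have "\<dots> = (\<Sum>y\<in>words n. \<Sum>x\<in>words n. flip_prob \<tau> x y * split_entropy (R True x) (R False x))"
    by (rule sum.swap)
  also have "\<dots> = (\<Sum>y\<in>words n. \<Sum>x\<in>words n.
      split_entropy (flip_prob \<tau> x y * R True x) (flip_prob \<tau> x y * R False x))"
    using \<tau> by (simp add: split_entropy_homogeneous flip_prob_nonneg R0)
  also have "\<dots> \<le> (\<Sum>y\<in>words n. split_entropy (noisy \<tau> (Suc n) P (True # y)) (noisy \<tau> (Suc n) P (False # y)))"
    unfolding Q using \<tau> by (intro sum_mono split_entropy_sum) (auto simp: R0 flip_prob_nonneg)
  finally have step: "(\<Sum>x\<in>words n. P' x) * (\<beta> - s * \<alpha>) +
      s * (\<Sum>x\<in>words n. split_entropy (P (True # x)) (P (False # x)))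
      \<le> (\<Sum>y\<in>words n. split_entropy (noisy \<tau> (Suc n) P (True # y)) (noisy \<tau> (Suc n) P (False # y)))"
    by (simp add: sum.distrib sum_distrib_left sum_distrib_right)
  have mass: "(\<Sum>x\<in>words (Suc n). P x) = (\<Sum>x\<in>words n. P' x)"
    by (simp add: sum_words_Suc P'_def)
  have "s * word_entropy n P' + (\<Sum>x\<in>words n. P' x) * (real n * (\<beta> - s * \<alpha>)) +
      (1 - s) * plog (\<Sum>x\<in>words n. P' x) \<le> word_entropy n (noisy \<tau> n P')"
    using Suc.prems by (intro Suc.IH) (auto simp: P'_def)
  with step show ?case
    unfolding word_entropy_Suc Q' mass P'_def[symmetric] by (simp add: algebra_simps)
qed

section \<open>Concentration and blowing up\<close>

text \<open>Hoeffding's lemma for a variable with the two values u and v.\<close>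

lemma bernoulli_mgf_bound:
  assumes "0 \<le> p" "p \<le> (1::real)"
  shows "(1 - p) * exp (h * u) + p * exp (h * v)
    \<le> exp (h * ((1 - p) * u + p * v) + h\<^sup>2 * (v - u)\<^sup>2 / 8)"
proof -
  have aux: "1 - p + p * exp k \<le> exp (k * p + k\<^sup>2 / 8)" if k: "0 \<le> k" and p: "0 \<le> p" "p \<le> 1" for k p :: real
  proof -
    have "0 < 1 - p + p * exp k"
      using p by (cases "p = 0") (auto intro: add_nonneg_pos)
    moreover have "ln (1 - p + p * exp k) \<le> k * p + k\<^sup>2 / 8"
      using Hoeffdings_lemma_aux[OF k p(1)] by (simp add: algebra_simps)
    ultimately show ?thesis by (metis exp_le_cancel_iff exp_ln)
  qed
  have aux2: "1 - p + p * exp k \<le> exp (k * p + k\<^sup>2 / 8)" for k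
  proof (cases "0 \<le> k")
    case True
    then show ?thesis using aux assms by simp
  next
    case False
    \<comment> \<open>For negative k the outcomes are exchanged: with exp k factored out, the bound
      applies to - k and 1 - p.\<close>
    have "exp k * (1 - (1 - p) + (1 - p) * exp (- k)) \<le> exp k * exp (- k * (1 - p) + (- k)\<^sup>2 / 8)"
      using False assms by (intro mult_left_mono aux) auto
    moreover have "exp k * (1 - (1 - p) + (1 - p) * exp (- k)) = 1 - p + p * exp k"
      by (simp add: algebra_simps flip: exp_add)
    moreover have "exp k * exp (- k * (1 - p) + (- k)\<^sup>2 / 8) = exp (k * p + k\<^sup>2 / 8)"
      by (simp add: algebra_simps flip: exp_add)
    ultimately show ?thesis by (simp only:)
  qed
  have "exp (h * u) * (1 - p + p * exp (h * (v - u))) \<le>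
      exp (h * u) * exp (h * (v - u) * p + (h * (v - u))\<^sup>2 / 8)"
    by (intro mult_left_mono aux2) auto
  moreover have "exp (h * u) * (1 - p + p * exp (h * (v - u))) =
      (1 - p) * exp (h * u) + p * exp (h * v)"
    by (simp add: algebra_simps flip: exp_add)
  moreover have "exp (h * u) * exp (h * (v - u) * p + (h * (v - u))\<^sup>2 / 8) =
      exp (h * ((1 - p) * u + p * v) + h\<^sup>2 * (v - u)\<^sup>2 / 8)"
    unfolding exp_add[symmetric] power_mult_distrib by (simp add: algebra_simps)
  ultimately show ?thesis by simp
qed

text \<open>On lists of different lengths the surplus is ignored, so this is a metric only among
  words of one length.\<close>

fun hamming :: "bstring \<Rightarrow> bstring \<Rightarrow> nat" where
  "hamming (a # x) (b # y) = (if a = b then 0 else 1) + hamming x y"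
| "hamming _ _ = 0"

lemma hamming_refl [simp]: "hamming x x = 0"
  by (induction x) auto

definition hamming_lipschitz :: "nat \<Rightarrow> (bstring \<Rightarrow> real) \<Rightarrow> bool" where
  "hamming_lipschitz n f \<longleftrightarrow>
     (\<forall>y\<in>words n. \<forall>z\<in>words n. \<bar>f y - f z\<bar> \<le> real (hamming y z))"

text \<open>McDiarmid's argument, by induction on the first bit: the conditional means of f given
  that bit differ by at most 1, so Hoeffding's lemma adds h^2 / 8 per coordinate.\<close>

lemma flip_prob_mgf_bound:
  assumes \<tau>: "0 \<le> \<tau>" "\<tau> \<le> 1"
    and "x \<in> words n" "hamming_lipschitz n f"
  shows "(\<Sum>y\<in>words n. flip_prob \<tau> x y * exp (h * f y)) \<le>
    exp (h * (\<Sum>y\<in>words n. flip_prob \<tau> x y * f y) + h\<^sup>2 * real n / 8)"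
  using assms(3,4)
proof (induction n arbitrary: x f)
  case (Suc n)
  then obtain a x' where x: "x = a # x'" and x': "x' \<in> words n"
    by (auto simp: words_def length_Suc_conv)
  have lip: "hamming_lipschitz n (\<lambda>y. f (b # y))" for b
    unfolding hamming_lipschitz_def
  proof (intro ballI)
    fix y z assume "y \<in> words n" "z \<in> words n"
    then have "b # y \<in> words (Suc n)" "b # z \<in> words (Suc n)" by (auto simp: words_def)
    then show "\<bar>f (b # y) - f (b # z)\<bar> \<le> real (hamming y z)"
      using Suc.prems(2) unfolding hamming_lipschitz_def by fastforce
  qed
  define m where "m = (\<lambda>b. \<Sum>y\<in>words n. flip_prob \<tau> x' y * f (b # y))"
  have IH: "(\<Sum>y\<in>words n. flip_prob \<tau> x' y * exp (h * f (b # y))) \<le> exp (h * m b + h\<^sup>2 * real n / 8)" for b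
    using Suc.IH[OF x' lip] by (simp add: m_def)
  have split: "(\<Sum>y\<in>words (Suc n). flip_prob \<tau> x y * F y) =
      (1 - \<tau>) * (\<Sum>y\<in>words n. flip_prob \<tau> x' y * F (a # y)) +
      \<tau> * (\<Sum>y\<in>words n. flip_prob \<tau> x' y * F ((\<not> a) # y))" for F
    unfolding sum_words_Suc x
    by (cases a) (auto simp: sum_distrib_left algebra_simps simp flip: sum.distrib)
  \<comment> \<open>Both means average over the same law of the tail, and the words compared differ
    only in their first letter.\<close>
  have diff: "\<bar>m (\<not> a) - m a\<bar> \<le> 1"
  proof -
    have "\<bar>m (\<not> a) - m a\<bar> = \<bar>\<Sum>y\<in>words n. flip_prob \<tau> x' y * (f ((\<not> a) # y) - f (a # y))\<bar>"
      by (simp add: m_def algebra_simps flip: sum_subtractf)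
    also have "\<dots> \<le> (\<Sum>y\<in>words n. \<bar>flip_prob \<tau> x' y * (f ((\<not> a) # y) - f (a # y))\<bar>)"
      by (rule sum_abs)
    also have "\<dots> \<le> (\<Sum>y\<in>words n. flip_prob \<tau> x' y)"
    proof (rule sum_mono)
      fix y assume y: "y \<in> words n"
      then have "(\<not> a) # y \<in> words (Suc n)" "a # y \<in> words (Suc n)" by (auto simp: words_def)
      then have "\<bar>f ((\<not> a) # y) - f (a # y)\<bar> \<le> real (hamming ((\<not> a) # y) (a # y))"
        using Suc.prems(2) unfolding hamming_lipschitz_def by blast
      then have "\<bar>f ((\<not> a) # y) - f (a # y)\<bar> \<le> 1" by simp
      then show "\<bar>flip_prob \<tau> x' y * (f ((\<not> a) # y) - f (a # y))\<bar> \<le> flip_prob \<tau> x' y"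
        using flip_prob_nonneg[OF \<tau>, of x' y] by (simp add: abs_mult mult_left_le)
    qed
    finally show ?thesis using x' by (simp add: sum_flip_prob)
  qed
  then have sq: "(m (\<not> a) - m a)\<^sup>2 \<le> 1" by (simp add: abs_square_le_1)
  have "(\<Sum>y\<in>words (Suc n). flip_prob \<tau> x y * exp (h * f y)) \<le>
      (1 - \<tau>) * exp (h * m a + h\<^sup>2 * real n / 8) + \<tau> * exp (h * m (\<not> a) + h\<^sup>2 * real n / 8)"
    unfolding split using \<tau> by (intro add_mono mult_left_mono IH) auto
  also have "\<dots> = ((1 - \<tau>) * exp (h * m a) + \<tau> * exp (h * m (\<not> a))) * exp (h\<^sup>2 * real n / 8)"
    by (simp add: exp_add algebra_simps)
  also have "\<dots> \<le> exp (h * ((1 - \<tau>) * m a + \<tau> * m (\<not> a)) + h\<^sup>2 * (m (\<not> a) - m a)\<^sup>2 / 8) * exp (h\<^sup>2 * real n / 8)"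
    using \<tau> by (intro mult_right_mono bernoulli_mgf_bound) auto
  also have "\<dots> \<le> exp (h * ((1 - \<tau>) * m a + \<tau> * m (\<not> a)) + h\<^sup>2 / 8) * exp (h\<^sup>2 * real n / 8)"
    using mult_left_mono[OF sq, of "h\<^sup>2"] by (intro mult_right_mono) auto
  also have "\<dots> = exp (h * ((1 - \<tau>) * m a + \<tau> * m (\<not> a)) + h\<^sup>2 * real (Suc n) / 8)"
    by (simp add: field_simps flip: exp_add)
  also have "(1 - \<tau>) * m a + \<tau> * m (\<not> a) = (\<Sum>y\<in>words (Suc n). flip_prob \<tau> x y * f y)"
    unfolding split m_def ..
  finally show ?case .
qed simp

section \<open>Hamming neighbourhoods\<close>

definition neighbours :: "bstring \<Rightarrow> bstring set" where
  "neighbours y = insert y ((\<lambda>i. y[i := \<not> y ! i]) ` {..<length y})"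

text \<open>On words of one length, the closed Hamming r-neighbourhood, generated one flip at a
  time. A factor n + 1 per step then bounds its size without binomial coefficients; the resulting r
  log n in the exponent is within the error budget.\<close>

fun thicken :: "nat \<Rightarrow> bstring set \<Rightarrow> bstring set" where
  "thicken 0 B = B"
| "thicken (Suc r) B = (\<Union>y\<in>thicken r B. neighbours y)"

lemma thicken_subset_words: "B \<subseteq> words n \<Longrightarrow> thicken r B \<subseteq> words n"
  by (induction r) (auto simp: neighbours_def words_def)

lemma card_neighbours: "card (neighbours y) \<le> length y + 1"
proof -
  have "card (neighbours y) \<le> Suc (card ((\<lambda>i. y[i := \<not> y ! i]) ` {..<length y}))"
    unfolding neighbours_def by (rule card_insert_le_m1) auto
  also have "\<dots> \<le> Suc (length y)"
    using card_image_le[of "{..<length y}" "\<lambda>i. y[i := \<not> y ! i]"] by simp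
  finally show ?thesis by simp
qed

lemma card_thicken:
  assumes "B \<subseteq> words n"
  shows "card (thicken r B) \<le> (n + 1) ^ r * card B"
proof (induction r)
  case (Suc r)
  have sub: "thicken r B \<subseteq> words n" by (rule thicken_subset_words[OF assms])
  then have fin: "finite (thicken r B)" by (rule finite_subset) simp
  have "card (thicken (Suc r) B) \<le> (\<Sum>y\<in>thicken r B. card (neighbours y))"
    using fin by (simp add: card_UN_le)
  also have "\<dots> \<le> (\<Sum>y\<in>thicken r B. n + 1)"
    using sub card_neighbours by (intro sum_mono) (fastforce simp: words_def)
  also have "\<dots> = card (thicken r B) * (n + 1)" by simp
  also have "\<dots> \<le> ((n + 1) ^ r * card B) * (n + 1)" by (intro mult_right_mono Suc.IH) simp
  finally show ?case by (simp add: mult_ac)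
qed simp

lemma hamming_le_length: "hamming x y \<le> length x"
  by (induction x y rule: hamming.induct) auto

lemma hamming_commute: "hamming x y = hamming y x"
  by (induction x y rule: hamming.induct) auto

lemma hamming_triangle:
  "length x = length y \<Longrightarrow> length y = length z \<Longrightarrow> hamming x z \<le> hamming x y + hamming y z"
  by (induction x y z rule: list_induct3) auto

lemma hamming_eq_0: "length x = length y \<Longrightarrow> hamming x y = 0 \<longleftrightarrow> x = y"
  by (induction x y rule: list_induct2) auto

lemma hamming_flip_closer:
  assumes "length y = length z" "0 < hamming y z"
  obtains i where "i < length y" "hamming (y[i := \<not> y ! i]) z = hamming y z - 1"
  using assms
proof (induction y z arbitrary: thesis rule: list_induct2)
  case (Cons a y b z)
  show ?case
  proof (cases "a = b")
    case True
    with Cons obtain i where "i < length y" "hamming (y[i := \<not> y ! i]) z = hamming y z - 1" by auto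
    then show ?thesis using True Cons.prems(1)[of "Suc i"] by simp
  next
    case False
    then show ?thesis using Cons.prems(1)[of 0] by auto
  qed
qed simp

text \<open>A flip brings y closer to z, and flipping the same bit back shows that y is a neighbour
  of the closer word.\<close>

lemma in_thickenI:
  assumes "z \<in> B" "length y = length z" "hamming y z \<le> r"
  shows "y \<in> thicken r B"
  using assms(2,3)
proof (induction r arbitrary: y)
  case 0
  then show ?case using assms(1) by (simp add: hamming_eq_0)
next
  case (Suc r)
  show ?case
  proof (cases "hamming y z = 0")
    case True
    then show ?thesis using Suc by (auto simp: neighbours_def)
  next
    case False
    then obtain i where i: "i < length y" "hamming (y[i := \<not> y ! i]) z = hamming y z - 1"
      using hamming_flip_closer Suc.prems by (metis neq0_conv)
    let ?y = "y[i := \<not> y ! i]"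
    have "?y \<in> thicken r B" using Suc i by auto
    moreover have "?y[i := \<not> ?y ! i] \<in> neighbours ?y"
      unfolding neighbours_def using i by (intro insertI2 imageI) simp
    then have "y \<in> neighbours ?y" using i by simp
    ultimately show ?thesis by auto
  qed
qed

text \<open>Concentration is used twice for the distance f to B. As f vanishes on B, whose mass is
  not too small, the lower tail forces the mean of f to be O(sqrt (n log n)). The upper tail then
  makes words at distance more than r from B rare.\<close>

lemma blow_up:
  assumes \<tau>: "0 \<le> \<tau>" "\<tau> \<le> 1" and n: "1 \<le> n" and x: "x \<in> words n" and B: "B \<subseteq> words n"
    and hit: "1 / (2 * real n) \<le> (\<Sum>y\<in>B. flip_prob \<tau> x y)"
    and r: "sqrt (2 * real n * ln (2 * real n)) \<le> real r"
  shows "1 - 1 / real n \<le> (\<Sum>y\<in>thicken r B. flip_prob \<tau> x y)"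
proof -
  have finB: "finite B" using B by (rule finite_subset) simp
  have "B \<noteq> {}" using hit n by auto
  define f where "f = (\<lambda>y. real (Min (hamming y ` B)))"
  have f_le: "f y \<le> real (hamming y z)" if "z \<in> B" for y z
    using that finB by (simp add: f_def)
  have f_att: "\<exists>z\<in>B. f y = real (hamming y z)" for y
  proof -
    have "Min (hamming y ` B) \<in> hamming y ` B" using finB \<open>B \<noteq> {}\<close> by (intro Min_in) auto
    then show ?thesis by (auto simp: f_def)
  qed
  have f0: "f y = 0" if "y \<in> B" for y
    using f_le[OF that, of y] by (simp add: f_def)
  have lip1: "f y \<le> f z + real (hamming y z)" if "y \<in> words n" "z \<in> words n" for y z
  proof -
    obtain w where w: "w \<in> B" "f z = real (hamming z w)" using f_att by blast
    have "hamming y w \<le> hamming y z + hamming z w"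
      using that w(1) B by (intro hamming_triangle) (auto simp: words_def)
    then show ?thesis using f_le[OF w(1), of y] w(2) by linarith
  qed
  have lip: "hamming_lipschitz n f"
    unfolding hamming_lipschitz_def using lip1 by (fastforce simp: hamming_commute abs_le_iff)
  define L where "L = ln (2 * real n)"
  have L: "0 < L" "exp (- L) = 1 / (2 * real n)"
    using n by (auto simp: L_def exp_minus inverse_eq_divide)
  \<comment> \<open>This h makes the variance term h^2 n / 8 equal to L. The lower tail gives h m <=
    2 L and the choice of r gives h r >= 4 L, so the upper tail is at most exp (2 L + L - 4 L) = 1 /
    (2 n).\<close>
  define h where "h = sqrt (8 * L / real n)"
  have h: "0 < h" "h\<^sup>2 * real n / 8 = L" using L n by (auto simp: h_def)
  have hr: "4 * L \<le> h * real r"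
  proof -
    have "4 * L = sqrt ((4 * L)\<^sup>2)" by (subst real_sqrt_abs) (use L in simp)
    also have "\<dots> = h * sqrt (2 * real n * L)"
      unfolding h_def using n by (simp add: power2_eq_square flip: real_sqrt_mult)
    also have "\<dots> \<le> h * real r" using r h by (intro mult_left_mono) (auto simp: L_def)
    finally show ?thesis .
  qed
  define m where "m = (\<Sum>y\<in>words n. flip_prob \<tau> x y * f y)"
  have K: "0 \<le> flip_prob \<tau> x y" for y using \<tau> by (rule flip_prob_nonneg)
  have "exp (- L) \<le> (\<Sum>y\<in>B. flip_prob \<tau> x y * exp (- h * f y))"
    using hit L f0 by simp
  also have "\<dots> \<le> (\<Sum>y\<in>words n. flip_prob \<tau> x y * exp (- h * f y))"
    using B K by (intro sum_mono2) auto
  also have "\<dots> \<le> exp (- h * m + L)"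
    using flip_prob_mgf_bound[OF \<tau> x lip, of "- h"] h by (simp add: m_def)
  finally have hm: "h * m \<le> 2 * L" by simp
  have "(\<Sum>y\<in>words n - thicken r B. flip_prob \<tau> x y)
      \<le> (\<Sum>y\<in>words n - thicken r B. flip_prob \<tau> x y * exp (h * (f y - real r)))"
  proof (rule sum_mono)
    fix y assume y: "y \<in> words n - thicken r B"
    obtain z where z: "z \<in> B" "f y = real (hamming y z)" using f_att by blast
    then have "real r \<le> f y"
      using in_thickenI[OF z(1), of y r] y B by (fastforce simp: words_def)
    then have "1 \<le> exp (h * (f y - real r))" using h by simp
    then show "flip_prob \<tau> x y \<le> flip_prob \<tau> x y * exp (h * (f y - real r))"
      using mult_left_mono[OF _ K[of y]] by fastforce
  qed
  also have "\<dots> \<le> (\<Sum>y\<in>words n. flip_prob \<tau> x y * exp (h * (f y - real r)))"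
    using K by (intro sum_mono2) auto
  also have "\<dots> = exp (- (h * real r)) * (\<Sum>y\<in>words n. flip_prob \<tau> x y * exp (h * f y))"
    unfolding sum_distrib_left
  proof (rule sum.cong[OF refl])
    fix y
    have "exp (h * (f y - real r)) = exp (- (h * real r)) * exp (h * f y)"
      by (simp add: right_diff_distrib flip: exp_add)
    then show "flip_prob \<tau> x y * exp (h * (f y - real r)) =
        exp (- (h * real r)) * (flip_prob \<tau> x y * exp (h * f y))" by simp
  qed
  also have "\<dots> \<le> exp (- (h * real r)) * exp (h * m + L)"
    using flip_prob_mgf_bound[OF \<tau> x lip, of h] h by (intro mult_left_mono) (auto simp: m_def)
  also have "\<dots> = exp (h * m + L - h * real r)" by (simp flip: exp_add)
  also have "\<dots> \<le> exp (- L)" using hm hr by simp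
  finally have "(\<Sum>y\<in>words n - thicken r B. flip_prob \<tau> x y) \<le> 1 / (2 * real n)" using L by simp
  moreover have "(\<Sum>y\<in>words n - thicken r B. flip_prob \<tau> x y) = 1 - (\<Sum>y\<in>thicken r B. flip_prob \<tau> x y)"
    using sum_diff[OF finite_words thicken_subset_words[OF B], of "flip_prob \<tau> x" r] sum_flip_prob[OF x]
    by simp
  moreover have "1 / (2 * real n) \<le> 1 / real n" using n by (simp add: field_simps)
  ultimately show ?thesis by linarith
qed

text \<open>Gibbs' inequality for a single term. Summed up, the correction is nonpositive once the
  total of the w does not exceed that of the q.\<close>

lemma plog_le_cross:
  assumes "0 \<le> q" "0 < w"
  shows "plog q \<le> - (q * log 2 w) + (w - q) / ln 2"
proof (cases "q = 0")
  case True
  then show ?thesis using assms by simp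
next
  case False
  then have q: "0 < q" using assms by simp
  have "ln (w / q) \<le> w / q - 1" using q assms by (intro ln_le_minus_one) auto
  then have "q * ln (w / q) \<le> q * (w / q - 1)" using q by (intro mult_left_mono) auto
  then have "q * (ln w - ln q) \<le> w - q" using q assms by (simp add: ln_div algebra_simps)
  then have "q * (ln w - ln q) / ln 2 \<le> (w - q) / ln 2" by (intro divide_right_mono) auto
  moreover have "q * (ln w - ln q) / ln 2 = q * log 2 w - q * log 2 q"
    by (simp add: log_def diff_divide_distrib algebra_simps)
  ultimately show ?thesis unfolding plog_def by linarith
qed

lemma word_entropy_concentrated_le:
  assumes n: "1 \<le> n" and Q: "\<And>y. 0 \<le> Q y" "(\<Sum>y\<in>words n. Q y) = 1"
    and C: "C \<subseteq> words n" "C \<noteq> {}" "1 - 1 / real n \<le> (\<Sum>y\<in>C. Q y)"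
  shows "word_entropy n Q \<le> 2 + log 2 (real (card C))"
proof -
  have finC: "finite C" using C(1) by (rule finite_subset) simp
  then have cC: "1 \<le> real (card C)" using C(2) by (simp add: Suc_le_eq card_gt_0_iff)
  \<comment> \<open>A coding distribution of total mass at most 1: one half is spread over C, the
    other at the rate of the uniform law on all words. A word in C costs 1 + log |C| bits and any
    other 1 + n, but the others have probability at most 1 / n; in the mean this is at most 2 + log
    |C|.\<close>
  define W where "W = (\<lambda>y. if y \<in> C then 1 / (2 * real (card C)) else 1 / (2 * 2 ^ n))"
  have W0: "0 < W y" for y using cC by (auto simp: W_def)
  have split: "(\<Sum>y\<in>words n. F y) = (\<Sum>y\<in>C. F y) + (\<Sum>y\<in>words n - C. F y)" for F :: "bstring \<Rightarrow> real"
    using sum.subset_diff[OF C(1) finite_words, of F] by simp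
  have W1: "(\<Sum>y\<in>words n. W y) \<le> 1"
  proof -
    have "(\<Sum>y\<in>words n. W y) = (\<Sum>y\<in>C. 1 / (2 * real (card C))) + (\<Sum>y\<in>words n - C. 1 / (2 * 2 ^ n))"
      unfolding split by (intro arg_cong2[where f = "(+)"] sum.cong) (auto simp: W_def)
    also have "\<dots> = 1 / 2 + real (card (words n - C)) / (2 * 2 ^ n)" using cC by simp
    also have "\<dots> \<le> 1 / 2 + 2 ^ n / (2 * 2 ^ n)"
    proof -
      have "card (words n - C) \<le> 2 ^ n"
        using card_mono[of "words n" "words n - C"] by (simp add: card_words)
      then have "real (card (words n - C)) \<le> 2 ^ n" by (metis of_nat_le_iff of_nat_numeral of_nat_power)
      then show ?thesis by (intro add_mono divide_right_mono) auto
    qed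
    finally show ?thesis by simp
  qed
  have lW: "- log 2 (W y) = (if y \<in> C then 1 + log 2 (real (card C)) else 1 + real n)" for y
    using cC by (auto simp: W_def log_divide log_mult log_nat_power)
  have "word_entropy n Q \<le> (\<Sum>y\<in>words n. - (Q y * log 2 (W y)) + (W y - Q y) / ln 2)"
    unfolding word_entropy_def using Q W0 by (intro sum_mono plog_le_cross) auto
  also have "\<dots> = (\<Sum>y\<in>words n. Q y * (- log 2 (W y))) + ((\<Sum>y\<in>words n. W y) - 1) / ln 2"
    using Q(2) by (simp add: sum.distrib sum_subtractf sum_divide_distrib[symmetric] sum_negf)
  also have "\<dots> \<le> (\<Sum>y\<in>words n. Q y * (- log 2 (W y)))"
    using W1 by (simp add: divide_nonpos_pos)
  also have "\<dots> = (\<Sum>y\<in>C. Q y * (1 + log 2 (real (card C)))) + (\<Sum>y\<in>words n - C. Q y * (1 + real n))"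
    unfolding split lW by (intro arg_cong2[where f = "(+)"] sum.cong) auto
  also have "\<dots> = 1 + (\<Sum>y\<in>C. Q y) * log 2 (real (card C)) + (\<Sum>y\<in>words n - C. Q y) * real n"
  proof -
    have "(\<Sum>y\<in>S. Q y * (1 + c)) = (\<Sum>y\<in>S. Q y) + (\<Sum>y\<in>S. Q y) * c" for S c
      by (simp add: distrib_left sum.distrib sum_distrib_right)
    then show ?thesis using Q(2) unfolding split by simp
  qed
  also have "\<dots> \<le> 1 + 1 * log 2 (real (card C)) + (1 / real n) * real n"
  proof -
    have "(\<Sum>y\<in>words n - C. Q y) \<le> 1 / real n" using C(3) Q(2) unfolding split by linarith
    moreover have "(\<Sum>y\<in>C. Q y) \<le> 1"
      using Q(2) sum_nonneg[of "words n - C" Q] Q(1) unfolding split by simp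
    ultimately show ?thesis using cC by (intro add_mono mult_right_mono) auto
  qed
  also have "\<dots> = 2 + log 2 (real (card C))" using n by simp
  finally show ?thesis .
qed

text \<open>
  The image of the uniform distribution on \<open>A\<close> has large entropy by the vector Gerber lemma, yet it is
  almost concentrated on a small thickening of \<open>B\<close>.
\<close>

lemma card_noisy_target_ge:
  assumes p: "0 \<le> p" "p \<le> 1 / 2" and \<tau>: "0 \<le> \<tau>" "\<tau> \<le> 1" and n: "1 \<le> n"
    and A: "A \<subseteq> words n" "A \<noteq> {}" and B: "B \<subseteq> words n"
    and hit: "\<And>x. x \<in> A \<Longrightarrow> 1 / (2 * real n) \<le> (\<Sum>y\<in>B. flip_prob \<tau> x y)"
    and r: "sqrt (2 * real n * ln (2 * real n)) \<le> real r"
    and e: "0 \<le> e" "binary_entropy p * real n - e \<le> log 2 (real (card A))"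
  shows "binary_entropy (noisy_param p \<tau>) * real n - e
    \<le> 2 + log 2 (real (card B)) + real r * log 2 (real n + 1)"
proof -
  have finA: "finite A" using A(1) by (rule finite_subset) simp
  have finB: "finite B" using B by (rule finite_subset) simp
  have cA: "0 < real (card A)" using finA A(2) by (simp add: card_gt_0_iff)
  obtain s where s: "0 \<le> s" "s \<le> 1" and tangent: "\<And>q. 0 \<le> q \<Longrightarrow> q \<le> 1 \<Longrightarrow>
      binary_entropy (noisy_param p \<tau>) + s * (binary_entropy q - binary_entropy p)
        \<le> binary_entropy (noisy_param q \<tau>)"
    using binary_entropy_noisy_tangent[OF p \<tau>] by metis
  define P where "P = (\<lambda>x. if x \<in> A then 1 / real (card A) else 0)"
  have P0: "0 \<le> P x" for x by (simp add: P_def)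
  have restrict: "(\<Sum>x\<in>words n. if x \<in> A then F x else 0) = (\<Sum>x\<in>A. F x)" for F :: "bstring \<Rightarrow> real"
    using A(1) by (simp add: sum.inter_restrict[symmetric] Int_absorb1)
  have P1: "(\<Sum>x\<in>words n. P x) = 1" unfolding P_def restrict using cA by simp
  have entP: "word_entropy n P = log 2 (real (card A))"
  proof -
    have "word_entropy n P = (\<Sum>x\<in>words n. if x \<in> A then plog (1 / real (card A)) else 0)"
      unfolding word_entropy_def by (intro sum.cong) (auto simp: P_def)
    also have "\<dots> = log 2 (real (card A))" unfolding restrict using cA by (simp add: plog_def log_divide)
    finally show ?thesis .
  qed
  let ?Q = "noisy \<tau> n P"
  have K: "0 \<le> flip_prob \<tau> x y" for x y using \<tau> by (rule flip_prob_nonneg)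
  have Q_sum: "(\<Sum>y\<in>S. ?Q y) = (\<Sum>x\<in>words n. P x * (\<Sum>y\<in>S. flip_prob \<tau> x y))" for S
    unfolding noisy_def by (subst sum.swap) (simp add: sum_distrib_left)
  have Q0: "0 \<le> ?Q y" for y unfolding noisy_def using P0 K by (intro sum_nonneg) auto
  have Q1: "(\<Sum>y\<in>words n. ?Q y) = 1"
    unfolding Q_sum using P1 by (simp add: sum_flip_prob)
  define C where "C = thicken r B"
  have C: "C \<subseteq> words n" unfolding C_def by (rule thicken_subset_words[OF B])
  have QC: "1 - 1 / real n \<le> (\<Sum>y\<in>C. ?Q y)"
  proof -
    have "1 - 1 / real n = (\<Sum>x\<in>words n. P x * (1 - 1 / real n))"
      using P1 by (simp flip: sum_distrib_right)
    also have "\<dots> \<le> (\<Sum>x\<in>words n. P x * (\<Sum>y\<in>C. flip_prob \<tau> x y))"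
    proof (rule sum_mono)
      fix x assume x: "x \<in> words n"
      show "P x * (1 - 1 / real n) \<le> P x * (\<Sum>y\<in>C. flip_prob \<tau> x y)"
      proof (cases "x \<in> A")
        case True
        then show ?thesis unfolding C_def
          using blow_up[OF \<tau> n x B hit r] P0 by (intro mult_left_mono) auto
      qed (simp add: P_def)
    qed
    finally show ?thesis unfolding Q_sum .
  qed
  have B_ne: "B \<noteq> {}"
  proof
    assume "B = {}"
    then show False using hit A(2) n by auto
  qed
  have C_ne: "C \<noteq> {}"
  proof -
    obtain z where "z \<in> B" using B_ne by blast
    then have "z \<in> C" unfolding C_def by (intro in_thickenI) auto
    then show ?thesis by blast
  qed
  have "s * word_entropy n P + real n * (binary_entropy (noisy_param p \<tau>) - s * binary_entropy p)
      \<le> word_entropy n ?Q"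
    using word_entropy_noisy_ge[OF \<tau> tangent, where P = P and n = n] P0 P1 by (simp add: plog_def)
  also have "\<dots> \<le> 2 + log 2 (real (card C))"
    by (rule word_entropy_concentrated_le[OF n Q0 Q1 C C_ne QC])
  also have "log 2 (real (card C)) \<le> log 2 (real ((n + 1) ^ r * card B))"
  proof -
    have cC: "0 < card C" using C C_ne finite_subset[OF C finite_words] by (simp add: card_gt_0_iff)
    have le: "card C \<le> (n + 1) ^ r * card B" unfolding C_def by (rule card_thicken[OF B])
    then have "real (card C) \<le> real ((n + 1) ^ r * card B)" by (simp only: of_nat_le_iff)
    from Transcendental.log_mono[OF _ _ this, of 2] cC show ?thesis by simp
  qed
  also have "log 2 (real ((n + 1) ^ r * card B)) = real r * log 2 (real n + 1) + log 2 (real (card B))"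
    using B_ne finB by (simp add: log_mult log_nat_power card_gt_0_iff add.commute)
  finally have "s * word_entropy n P + real n * (binary_entropy (noisy_param p \<tau>) - s * binary_entropy p)
      \<le> 2 + (real r * log 2 (real n + 1) + log 2 (real (card B)))" by simp
  moreover have "s * (binary_entropy p * real n - e) \<le> s * word_entropy n P"
    unfolding entP using s e by (intro mult_left_mono) auto
  \<comment> \<open>By s <= 1 the entropy deficit \<open>e\<close> of the input is not amplified.
    This is the point where uniformity in p and \<tau> is secured.\<close>
  moreover have "s * e \<le> e" using s e by (simp add: mult_left_le_one_le)
  moreover have "s * (binary_entropy p * real n - e) = real n * (s * binary_entropy p) - s * e"
    "real n * (binary_entropy (noisy_param p \<tau>) - s * binary_entropy p) =
      binary_entropy (noisy_param p \<tau>) * real n - real n * (s * binary_entropy p)"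
    by (simp_all add: right_diff_distrib mult_ac)
  ultimately show ?thesis by linarith
qed

section \<open>Total recursive functions and bounded simulation\<close>

text \<open>Arities are recorded here, since \<open>recf\<close> does not track them. Functions act
  on the whole argument list, so that closure properties work as introduction rules for terms built
  from \<open>xs ! i\<close>.\<close>

definition total_rec :: "nat \<Rightarrow> (nat list \<Rightarrow> nat) \<Rightarrow> bool" where
  "total_rec k f \<longleftrightarrow> (\<exists>r. \<forall>xs. length xs = k \<longrightarrow> recf_eval r xs = Some (f xs))"

definition total_rec_list :: "nat \<Rightarrow> (nat list \<Rightarrow> nat list) \<Rightarrow> bool" where
  "total_rec_list k G \<longleftrightarrow>
     (\<exists>rs. \<forall>xs. length xs = k \<longrightarrow> those (map (\<lambda>r. recf_eval r xs) rs) = Some (G xs))"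

lemma total_rec_cong:
  assumes "total_rec k f" "\<And>xs. length xs = k \<Longrightarrow> f xs = g xs"
  shows "total_rec k g"
  using assms unfolding total_rec_def by metis

lemma total_rec_nth: "i < k \<Longrightarrow> total_rec k (\<lambda>xs. xs ! i)"
  unfolding total_rec_def by (intro exI[of _ "Proj i"]) auto

lemma total_rec_drop_nth: "d + i < k \<Longrightarrow> total_rec k (\<lambda>xs. drop d xs ! i)"
  by (rule total_rec_cong[OF total_rec_nth[of "d + i"]]) auto

lemma total_rec_list_Nil: "total_rec_list k (\<lambda>xs. [])"
  unfolding total_rec_list_def by (intro exI[of _ "[]"]) auto

lemma total_rec_list_Cons:
  assumes "total_rec k f" "total_rec_list k G"
  shows "total_rec_list k (\<lambda>xs. f xs # G xs)"
proof -
  from assms obtain r rs where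
    "\<forall>xs. length xs = k \<longrightarrow> recf_eval r xs = Some (f xs)"
    "\<forall>xs. length xs = k \<longrightarrow> those (map (\<lambda>r. recf_eval r xs) rs) = Some (G xs)"
    unfolding total_rec_def total_rec_list_def by blast
  then show ?thesis
    unfolding total_rec_list_def by (intro exI[of _ "r # rs"]) auto
qed

lemma total_rec_list_map:
  "(\<And>g. g \<in> set gs \<Longrightarrow> total_rec k (F g)) \<Longrightarrow> total_rec_list k (\<lambda>xs. map (\<lambda>g. F g xs) gs)"
  by (induction gs) (auto intro: total_rec_list_Nil total_rec_list_Cons)

lemma total_rec_list_drop: "total_rec_list k (\<lambda>xs. drop d xs)"
proof -
  have "total_rec_list k (\<lambda>xs. map (\<lambda>i. xs ! i) [d..<k])"
    by (rule total_rec_list_map) (auto intro: total_rec_nth)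
  then show ?thesis
    unfolding total_rec_list_def by (metis drop_map drop_upt map_nth add_0)
qed

lemma total_rec_comp:
  assumes "total_rec m f" "total_rec_list k G" "\<And>xs. length xs = k \<Longrightarrow> length (G xs) = m"
  shows "total_rec k (\<lambda>xs. f (G xs))"
proof -
  from assms(1,2) obtain r rs where
    "\<forall>xs. length xs = m \<longrightarrow> recf_eval r xs = Some (f xs)"
    "\<forall>xs. length xs = k \<longrightarrow> those (map (\<lambda>r. recf_eval r xs) rs) = Some (G xs)"
    unfolding total_rec_def total_rec_list_def by blast
  with assms(3) show ?thesis
    unfolding total_rec_def by (intro exI[of _ "Comp r rs"]) auto
qed

lemma total_rec_comp1:
  assumes "total_rec 1 (\<lambda>ys. f (ys ! 0))" "total_rec k a"
  shows "total_rec k (\<lambda>xs. f (a xs))"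
  using total_rec_comp[OF assms(1), of k "\<lambda>xs. [a xs]"] assms(2)
  by (simp add: total_rec_list_Cons total_rec_list_Nil)

lemma total_rec_comp2:
  assumes "total_rec 2 (\<lambda>ys. f (ys ! 0) (ys ! 1))" "total_rec k a" "total_rec k b"
  shows "total_rec k (\<lambda>xs. f (a xs) (b xs))"
  using total_rec_comp[OF assms(1), of k "\<lambda>xs. [a xs, b xs]"] assms(2-)
  by (simp add: total_rec_list_Cons total_rec_list_Nil)

lemma total_rec_comp3:
  assumes "total_rec 3 (\<lambda>ys. f (ys ! 0) (ys ! 1) (ys ! 2))"
    "total_rec k a" "total_rec k b" "total_rec k c"
  shows "total_rec k (\<lambda>xs. f (a xs) (b xs) (c xs))"
  using total_rec_comp[OF assms(1), of k "\<lambda>xs. [a xs, b xs, c xs]"] assms(2-)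
  by (simp add: total_rec_list_Cons total_rec_list_Nil)

lemma total_rec_comp4:
  assumes "total_rec 4 (\<lambda>ys. f (ys ! 0) (ys ! 1) (ys ! 2) (ys ! 3))"
    "total_rec k a" "total_rec k b" "total_rec k c" "total_rec k d"
  shows "total_rec k (\<lambda>xs. f (a xs) (b xs) (c xs) (d xs))"
  using total_rec_comp[OF assms(1), of k "\<lambda>xs. [a xs, b xs, c xs, d xs]"] assms(2-)
  by (simp add: total_rec_list_Cons total_rec_list_Nil)

lemma total_rec_comp5:
  assumes "total_rec 5 (\<lambda>ys. f (ys ! 0) (ys ! 1) (ys ! 2) (ys ! 3) (ys ! 4))"
    "total_rec k a" "total_rec k b" "total_rec k c" "total_rec k d" "total_rec k e"
  shows "total_rec k (\<lambda>xs. f (a xs) (b xs) (c xs) (d xs) (e xs))"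
  using total_rec_comp[OF assms(1), of k "\<lambda>xs. [a xs, b xs, c xs, d xs, e xs]"] assms(2-)
  by (simp add: total_rec_list_Cons total_rec_list_Nil)

lemma total_rec_Suc: "total_rec k a \<Longrightarrow> total_rec k (\<lambda>xs. Suc (a xs))"
proof (rule total_rec_comp1[where f = Suc])
  show "total_rec 1 (\<lambda>ys. Suc (ys ! 0))"
    unfolding total_rec_def by (intro exI[of _ Succ]) (auto simp: length_Suc_conv)
qed

lemma total_rec_const: "total_rec k (\<lambda>xs. c)"
proof (induction c)
  case 0
  show ?case unfolding total_rec_def by (intro exI[of _ Zero]) auto
qed (rule total_rec_Suc)

lemma total_rec_rec_nat:
  assumes f: "total_rec k f" and g: "total_rec (Suc (Suc k)) (\<lambda>ys. g (ys ! 0) (ys ! 1) (drop 2 ys))"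
    and m: "total_rec k m"
  shows "total_rec k (\<lambda>xs. rec_nat (f xs) (\<lambda>i v. g i v xs) (m xs))"
proof -
  from f obtain rf where rf: "\<And>xs. length xs = k \<Longrightarrow> recf_eval rf xs = Some (f xs)"
    unfolding total_rec_def by blast
  from g obtain rg where rg: "\<And>ys. length ys = Suc (Suc k) \<Longrightarrow>
      recf_eval rg ys = Some (g (ys ! 0) (ys ! 1) (drop 2 ys))"
    unfolding total_rec_def by blast
  have "recf_eval (PrimRec rf rg) (n # xs) = Some (rec_nat (f xs) (\<lambda>i v. g i v xs) n)"
    if "length xs = k" for n xs
    using that by (induction n) (auto simp: rf rg numeral_2_eq_2)
  then have "total_rec (Suc k) (\<lambda>ys. rec_nat (f (tl ys)) (\<lambda>i v. g i v (tl ys)) (hd ys))"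
    unfolding total_rec_def by (intro exI[of _ "PrimRec rf rg"]) (auto simp: length_Suc_conv)
  moreover have "total_rec_list k (\<lambda>xs. m xs # xs)"
    using total_rec_list_Cons[OF m total_rec_list_drop[of k 0]] by simp
  ultimately have "total_rec k (\<lambda>xs. (\<lambda>ys. rec_nat (f (tl ys)) (\<lambda>i v. g i v (tl ys)) (hd ys)) (m xs # xs))"
    by (rule total_rec_comp) simp
  then show ?thesis by simp
qed

lemma total_rec_add: "total_rec k a \<Longrightarrow> total_rec k b \<Longrightarrow> total_rec k (\<lambda>xs. a xs + b xs)"
proof (rule total_rec_comp2[where f = "(+)"])
  have "total_rec 2 (\<lambda>ys. rec_nat (ys ! 1) (\<lambda>i v. Suc v) (ys ! 0))"
    by (intro total_rec_rec_nat total_rec_nth total_rec_Suc) auto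
  moreover have "rec_nat y (\<lambda>i v. Suc v) x = x + y" for x y :: nat by (induction x) auto
  ultimately show "total_rec 2 (\<lambda>ys. ys ! 0 + ys ! 1)" by simp
qed

lemma total_rec_mult: "total_rec k a \<Longrightarrow> total_rec k b \<Longrightarrow> total_rec k (\<lambda>xs. a xs * b xs)"
proof (rule total_rec_comp2[where f = "(*)"])
  have "total_rec 2 (\<lambda>ys. rec_nat 0 (\<lambda>i v. v + ys ! 1) (ys ! 0))"
    by (intro total_rec_rec_nat total_rec_nth total_rec_drop_nth total_rec_add total_rec_const) auto
  moreover have "rec_nat 0 (\<lambda>i v. v + y) x = x * y" for x y :: nat by (induction x) auto
  ultimately show "total_rec 2 (\<lambda>ys. ys ! 0 * ys ! 1)" by simp
qed

lemma total_rec_power: "total_rec k a \<Longrightarrow> total_rec k b \<Longrightarrow> total_rec k (\<lambda>xs. a xs ^ b xs)"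
proof (rule total_rec_comp2[where f = "(^)"])
  have "total_rec 2 (\<lambda>ys. rec_nat 1 (\<lambda>i v. v * ys ! 0) (ys ! 1))"
    by (intro total_rec_rec_nat total_rec_nth total_rec_drop_nth total_rec_mult total_rec_const) auto
  moreover have "rec_nat 1 (\<lambda>i v. v * x) y = x ^ y" for x y :: nat by (induction y) auto
  ultimately show "total_rec 2 (\<lambda>ys. ys ! 0 ^ ys ! 1)" by simp
qed

lemma total_rec_diff: "total_rec k a \<Longrightarrow> total_rec k b \<Longrightarrow> total_rec k (\<lambda>xs. a xs - b xs)"
proof (rule total_rec_comp2[where f = "(-)"])
  have "total_rec 1 (\<lambda>ys. rec_nat 0 (\<lambda>i v. i) (ys ! 0))"
    by (intro total_rec_rec_nat total_rec_nth total_rec_const) auto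
  moreover have "rec_nat 0 (\<lambda>i v. i) x = x - 1" for x :: nat by (cases x) auto
  ultimately have pred: "total_rec 1 (\<lambda>ys. ys ! 0 - 1)" by simp
  have "total_rec 2 (\<lambda>ys. rec_nat (ys ! 0) (\<lambda>i v. v - 1) (ys ! 1))"
    by (intro total_rec_rec_nat total_rec_nth total_rec_comp1[OF pred]) auto
  moreover have "rec_nat x (\<lambda>i v. v - 1) y = x - y" for x y :: nat by (induction y) auto
  ultimately show "total_rec 2 (\<lambda>ys. ys ! 0 - ys ! 1)" by simp
qed

text \<open>Bounded sums carry the remaining arithmetic: bounded quantifiers, division, the exponent
  of 2 and the rank in an enumeration are all obtained from sums of truth values.\<close>

lemma total_rec_sum:
  assumes "total_rec (Suc k) (\<lambda>ys. f (ys ! 0) (drop 1 ys))" "total_rec k b"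
  shows "total_rec k (\<lambda>xs. \<Sum>i<b xs. f i xs)"
proof -
  have "total_rec_list (Suc (Suc k)) (\<lambda>ys. ys ! 0 # drop 2 ys)"
    by (intro total_rec_list_Cons total_rec_list_drop total_rec_nth) auto
  from total_rec_comp[OF assms(1) this]
  have "total_rec (Suc (Suc k)) (\<lambda>ys. f (ys ! 0) (drop 2 ys))" by simp
  then have "total_rec k (\<lambda>xs. rec_nat 0 (\<lambda>i v. v + f i xs) (b xs))"
    by (intro total_rec_rec_nat total_rec_add total_rec_nth total_rec_const assms(2)) auto
  moreover have "rec_nat 0 (\<lambda>i v. v + g i) n = (\<Sum>i<n. g i)" for n and g :: "nat \<Rightarrow> nat"
    by (induction n) auto
  ultimately show ?thesis by simp
qed

section \<open>Decidable predicates and bounded quantifiers\<close>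

definition decidable :: "nat \<Rightarrow> (nat list \<Rightarrow> bool) \<Rightarrow> bool" where
  "decidable k P \<longleftrightarrow> total_rec k (\<lambda>xs. of_bool (P xs))"

lemma total_rec_of_bool: "decidable k P \<Longrightarrow> total_rec k (\<lambda>xs. of_bool (P xs))"
  by (simp add: decidable_def)

lemma decidable_comp4:
  assumes "decidable 4 (\<lambda>ys. P (ys ! 0) (ys ! 1) (ys ! 2) (ys ! 3))"
    "total_rec k a" "total_rec k b" "total_rec k c" "total_rec k d"
  shows "decidable k (\<lambda>xs. P (a xs) (b xs) (c xs) (d xs))"
  using total_rec_comp4[where f = "\<lambda>a b c d. of_bool (P a b c d)"] assms
  unfolding decidable_def by blast

lemma decidable_comp5:
  assumes "decidable 5 (\<lambda>ys. P (ys ! 0) (ys ! 1) (ys ! 2) (ys ! 3) (ys ! 4))"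
    "total_rec k a" "total_rec k b" "total_rec k c" "total_rec k d" "total_rec k e"
  shows "decidable k (\<lambda>xs. P (a xs) (b xs) (c xs) (d xs) (e xs))"
  using total_rec_comp5[where f = "\<lambda>a b c d e. of_bool (P a b c d e)"] assms
  unfolding decidable_def by blast

lemma decidable_less:
  assumes "total_rec k a" "total_rec k b"
  shows "decidable k (\<lambda>xs. a xs < b xs)"
proof -
  \<comment> \<open>Truncated subtraction as a sign function: 1 - (1 - d) is 1 for d > 0 and 0 for d
    = 0.\<close>
  have "total_rec k (\<lambda>xs. 1 - (1 - (b xs - a xs)))"
    by (intro total_rec_diff total_rec_const assms)
  then show ?thesis unfolding decidable_def by (rule total_rec_cong) auto
qed

lemma decidable_not: "decidable k P \<Longrightarrow> decidable k (\<lambda>xs. \<not> P xs)"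
  unfolding decidable_def
  by (drule total_rec_diff[OF total_rec_const[of _ 1]]) (auto elim: total_rec_cong)

lemma decidable_conj: "decidable k P \<Longrightarrow> decidable k Q \<Longrightarrow> decidable k (\<lambda>xs. P xs \<and> Q xs)"
  unfolding decidable_def
  by (drule (1) total_rec_mult) (auto elim: total_rec_cong)

lemma decidable_le: "total_rec k a \<Longrightarrow> total_rec k b \<Longrightarrow> decidable k (\<lambda>xs. a xs \<le> b xs)"
  using decidable_not[OF decidable_less[of k b a]] by (simp add: not_less)

lemma decidable_eq: "total_rec k a \<Longrightarrow> total_rec k b \<Longrightarrow> decidable k (\<lambda>xs. a xs = b xs)"
  using decidable_conj[OF decidable_le[of k a b] decidable_le[of k b a]] by (simp add: eq_iff)

lemma decidable_bex:
  assumes "decidable (Suc k) (\<lambda>ys. P (ys ! 0) (drop 1 ys))" "total_rec k b"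
  shows "decidable k (\<lambda>xs. \<exists>i<b xs. P i xs)"
proof -
  have "total_rec k (\<lambda>xs. \<Sum>i<b xs. of_bool (P i xs))"
    using assms by (intro total_rec_sum total_rec_of_bool)
  then have "decidable k (\<lambda>xs. 0 < (\<Sum>i<b xs. of_bool (P i xs) :: nat))"
    by (intro decidable_less total_rec_const)
  moreover have "0 < (\<Sum>i<n. of_bool (Q i) :: nat) \<longleftrightarrow> (\<exists>i<n. Q i)" for n :: nat and Q
    by (subst neq0_conv[symmetric]) auto
  ultimately show ?thesis by simp
qed

lemma decidable_ball:
  assumes "decidable (Suc k) (\<lambda>ys. P (ys ! 0) (drop 1 ys))" "total_rec k b"
  shows "decidable k (\<lambda>xs. \<forall>i<b xs. P i xs)"
  using decidable_not[OF decidable_bex[OF decidable_not[OF assms(1)] assms(2)]] by simp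

lemma total_rec_if:
  assumes "decidable k P" "total_rec k a" "total_rec k b"
  shows "total_rec k (\<lambda>xs. if P xs then a xs else b xs)"
proof -
  have "total_rec k (\<lambda>xs. of_bool (P xs) * a xs + of_bool (\<not> P xs) * b xs)"
    by (intro total_rec_add total_rec_mult total_rec_of_bool decidable_not assms)
  then show ?thesis by (rule total_rec_cong) auto
qed

lemma total_rec_div: "total_rec k a \<Longrightarrow> total_rec k b \<Longrightarrow> total_rec k (\<lambda>xs. a xs div b xs)"
proof (rule total_rec_comp2[where f = "(div)"])
  \<comment> \<open>The quotient counts the positive multiples of the divisor up to the dividend;
    the guard yields x div 0 = 0.\<close>
  have "total_rec 2 (\<lambda>ys. \<Sum>z<ys ! 0. of_bool (0 < ys ! 1 \<and> Suc z * ys ! 1 \<le> ys ! 0))"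
    by (intro total_rec_sum total_rec_of_bool decidable_conj decidable_less decidable_le
        total_rec_mult total_rec_Suc total_rec_const total_rec_nth total_rec_drop_nth) auto
  moreover have "(\<Sum>z<x. of_bool (0 < y \<and> Suc z * y \<le> x)) = x div y" for x y :: nat
  proof (cases "y = 0")
    case False
    have "z < x \<and> Suc z * y \<le> x \<longleftrightarrow> z < x div y" for z
    proof -
      have "z < x div y \<longleftrightarrow> Suc z * y \<le> x"
        using False by (simp add: less_eq_div_iff_mult_less_eq Suc_le_eq[symmetric])
      moreover have "x div y \<le> x" by simp
      ultimately show ?thesis by linarith
    qed
    then have "{..<x} \<inter> {z. Suc z * y \<le> x} = {..<x div y}" by blast
    then have "card ({..<x} \<inter> {z. Suc z * y \<le> x}) = x div y" by simp
    then show ?thesis using False by (simp add: sum.If_cases of_bool_def)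
  qed simp
  ultimately show "total_rec 2 (\<lambda>ys. ys ! 0 div ys ! 1)" by simp
qed

lemma total_rec_mod: "total_rec k a \<Longrightarrow> total_rec k b \<Longrightarrow> total_rec k (\<lambda>xs. a xs mod b xs)"
  unfolding minus_div_mult_eq_mod[symmetric]
  by (intro total_rec_diff total_rec_mult total_rec_div)

lemmas rec_intros =
  total_rec_nth total_rec_drop_nth total_rec_const total_rec_Suc total_rec_add total_rec_mult
  total_rec_power total_rec_diff total_rec_div total_rec_mod total_rec_sum total_rec_if
  total_rec_of_bool decidable_less decidable_le decidable_eq decidable_not decidable_conj
  decidable_bex decidable_ball

text \<open>
  \<open>S (t # xs)\<close> is \<open>0\<close> while the computation of \<open>r\<close> on \<open>xs\<close> has not been seen to halt at stage \<open>t\<close>,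
  and the successor of the result afterwards.
\<close>

definition stage_evaluator :: "recf \<Rightarrow> nat \<Rightarrow> (nat list \<Rightarrow> nat) \<Rightarrow> bool" where
  "stage_evaluator r k S \<longleftrightarrow> total_rec (Suc k) S \<and>
     (\<forall>xs. length xs = k \<longrightarrow>
        (\<forall>t v. S (t # xs) = Suc v \<longrightarrow> recf_eval r xs = Some v) \<and>
        (\<forall>v. recf_eval r xs = Some v \<longrightarrow> (\<forall>\<^sub>F t in sequentially. S (t # xs) = Suc v)))"

lemma stage_evaluatorI:
  assumes "total_rec (Suc k) S"
    and "\<And>xs t v. length xs = k \<Longrightarrow> S (t # xs) = Suc v \<Longrightarrow> recf_eval r xs = Some v"
    and "\<And>xs v. length xs = k \<Longrightarrow> recf_eval r xs = Some v \<Longrightarrow> \<forall>\<^sub>F t in sequentially. S (t # xs) = Suc v"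
  shows "stage_evaluator r k S"
  using assms by (simp add: stage_evaluator_def)

lemma stage_evaluatorD:
  assumes "stage_evaluator r k S"
  shows stage_evaluator_total_rec: "total_rec (Suc k) S"
    and stage_evaluator_sound: "length xs = k \<Longrightarrow> S (t # xs) = Suc v \<Longrightarrow> recf_eval r xs = Some v"
    and stage_evaluator_complete:
      "length xs = k \<Longrightarrow> recf_eval r xs = Some v \<Longrightarrow> \<forall>\<^sub>F t in sequentially. S (t # xs) = Suc v"
  using assms by (simp_all add: stage_evaluator_def)

lemma those_eq_Some_iff:
  "those (map e gs) = Some vs \<longleftrightarrow> (\<forall>g\<in>set gs. e g \<noteq> None) \<and> vs = map (\<lambda>g. the (e g)) gs"
  by (induction gs arbitrary: vs) (auto split: option.splits)

text \<open>All subcomputations share one stage t. Soundness holds stage by stage, and finitely many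
  completeness statements hold together from some stage on, so the behaviour in between need not be
  tracked.\<close>

lemma stage_evaluator_Comp:
  assumes f: "stage_evaluator f (length gs) F"
    and gs: "\<And>g. g \<in> set gs \<Longrightarrow> stage_evaluator g k (G g)"
  shows "stage_evaluator (Comp f gs) k
    (\<lambda>ys. if \<forall>g\<in>set gs. 0 < G g ys then F (ys ! 0 # map (\<lambda>g. G g ys - 1) gs) else 0)"
    (is "stage_evaluator _ _ ?S")
proof (rule stage_evaluatorI)
  note Gr = stage_evaluator_total_rec[OF gs]
  have dec: "decidable (Suc k) (\<lambda>ys. \<forall>g\<in>set hs. 0 < G g ys)" if "set hs \<subseteq> set gs" for hs
    using that
  proof (induction hs)
    case Nil
    then show ?case by (simp add: decidable_def total_rec_const)
  next
    case (Cons h hs)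
    then show ?case using decidable_conj[OF decidable_less[OF total_rec_const Gr[of h]]] by simp
  qed
  have "total_rec_list (Suc k) (\<lambda>ys. ys ! 0 # map (\<lambda>g. G g ys - 1) gs)"
    by (intro total_rec_list_Cons total_rec_list_map total_rec_diff total_rec_nth total_rec_const Gr) auto
  from total_rec_comp[OF stage_evaluator_total_rec[OF f] this]
  have "total_rec (Suc k) (\<lambda>ys. F (ys ! 0 # map (\<lambda>g. G g ys - 1) gs))" by simp
  then show "total_rec (Suc k) ?S"
    by (intro total_rec_if dec total_rec_const) auto
next
  fix xs t v assume xs: "length xs = k" and S: "?S (t # xs) = Suc v"
  then have pos: "\<forall>g\<in>set gs. 0 < G g (t # xs)"
    and F: "F (t # map (\<lambda>g. G g (t # xs) - 1) gs) = Suc v" by (auto split: if_splits)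
  have g: "recf_eval g xs = Some (G g (t # xs) - 1)" if "g \<in> set gs" for g
    using pos that by (intro stage_evaluator_sound[OF gs[OF that] xs, of t]) auto
  have "those (map (\<lambda>g. recf_eval g xs) gs) = Some (map (\<lambda>g. G g (t # xs) - 1) gs)"
    unfolding those_eq_Some_iff using g by auto
  moreover have "recf_eval f (map (\<lambda>g. G g (t # xs) - 1) gs) = Some v"
    by (rule stage_evaluator_sound[OF f _ F]) simp
  ultimately show "recf_eval (Comp f gs) xs = Some v" by simp
next
  fix xs v assume xs: "length xs = k" and ev: "recf_eval (Comp f gs) xs = Some v"
  define vs where "vs = map (\<lambda>g. the (recf_eval g xs)) gs"
  from ev have g: "\<forall>g\<in>set gs. recf_eval g xs \<noteq> None" and fv: "recf_eval f vs = Some v"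
    unfolding vs_def by (auto simp: bind_eq_Some_conv those_eq_Some_iff)
  have "\<forall>\<^sub>F t in sequentially. F (t # vs) = Suc v"
    by (rule stage_evaluator_complete[OF f _ fv]) (simp add: vs_def)
  moreover have "\<forall>\<^sub>F t in sequentially. \<forall>g\<in>set gs. G g (t # xs) = Suc (the (recf_eval g xs))"
    using g by (intro eventually_ball_finite ballI stage_evaluator_complete[OF gs _ ] xs) auto
  ultimately show "\<forall>\<^sub>F t in sequentially. ?S (t # xs) = Suc v"
  proof eventually_elim
    case (elim t)
    then have "map (\<lambda>g. G g (t # xs) - 1) gs = vs" by (simp add: vs_def)
    with elim show ?case by simp
  qed
qed

lemma stage_evaluator_PrimRec:
  assumes f: "stage_evaluator f k F" and g: "stage_evaluator g (Suc (Suc k)) G"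
  shows "stage_evaluator (PrimRec f g) (Suc k)
    (\<lambda>ys. rec_nat (F (ys ! 0 # drop 2 ys))
       (\<lambda>i v. if 0 < v then G (ys ! 0 # i # (v - 1) # drop 2 ys) else 0) (ys ! 1))"
    (is "stage_evaluator _ _ ?S")
proof -
  define R where "R = (\<lambda>t xs. rec_nat (F (t # xs)) (\<lambda>i v. if 0 < v then G (t # i # (v - 1) # xs) else 0))"
  have S: "?S (t # n # xs) = R t xs n" for t n xs by (simp add: R_def cong: if_cong)
  show ?thesis
  proof (rule stage_evaluatorI)
    have "total_rec_list (Suc (Suc k)) (\<lambda>ys. ys ! 0 # drop 2 ys)"
      by (intro total_rec_list_Cons total_rec_list_drop total_rec_nth) auto
    from total_rec_comp[OF stage_evaluator_total_rec[OF f] this]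
    have 1: "total_rec (Suc (Suc k)) (\<lambda>ys. F (ys ! 0 # drop 2 ys))" by simp
    have "total_rec_list (Suc (Suc (Suc (Suc k)))) (\<lambda>ys. drop 2 ys ! 0 # ys ! 0 # (ys ! 1 - 1) # drop 4 ys)"
      by (intro total_rec_list_Cons total_rec_list_drop total_rec_diff total_rec_nth
          total_rec_drop_nth total_rec_const) auto
    from total_rec_comp[OF stage_evaluator_total_rec[OF g] this]
    have 2: "total_rec (Suc (Suc (Suc (Suc k))))
        (\<lambda>ys. G (drop 2 ys ! 0 # ys ! 0 # (ys ! 1 - 1) # drop 2 (drop 2 ys)))" by simp
    show "total_rec (Suc (Suc k)) ?S"
      by (intro total_rec_rec_nat total_rec_if decidable_less total_rec_nth total_rec_const 1 2) auto
  next
    fix ys t v assume "length ys = Suc k" and Sv: "?S (t # ys) = Suc v"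
    then obtain n xs where ys: "ys = n # xs" "length xs = k" by (auto simp: length_Suc_conv)
    have "recf_eval (PrimRec f g) (m # xs) = Some u" if "R t xs m = Suc u" for m u
      using that
    proof (induction m arbitrary: u)
      case 0
      then show ?case using stage_evaluator_sound[OF f ys(2)] by (simp add: R_def)
    next
      case (Suc m)
      define w where "w = R t xs m"
      from Suc.prems have w: "0 < w" "G (t # m # (w - 1) # xs) = Suc u"
        by (auto simp: w_def R_def split: if_splits)
      then have "recf_eval (PrimRec f g) (m # xs) = Some (w - 1)" by (intro Suc.IH) (simp add: w_def)
      moreover have "recf_eval g (m # (w - 1) # xs) = Some u"
        using w(2) ys(2) by (intro stage_evaluator_sound[OF g]) auto
      ultimately show ?case by simp
    qed
    then show "recf_eval (PrimRec f g) ys = Some v" using Sv unfolding ys(1) S by blast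
  next
    fix ys v assume "length ys = Suc k" and ev: "recf_eval (PrimRec f g) ys = Some v"
    then obtain n xs where ys: "ys = n # xs" "length xs = k" by (auto simp: length_Suc_conv)
    have "\<forall>\<^sub>F t in sequentially. R t xs m = Suc u"
      if "recf_eval (PrimRec f g) (m # xs) = Some u" for m u
      using that
    proof (induction m arbitrary: u)
      case 0
      then show ?case using stage_evaluator_complete[OF f ys(2)] by (simp add: R_def)
    next
      case (Suc m)
      then obtain w where w: "recf_eval (PrimRec f g) (m # xs) = Some w" "recf_eval g (m # w # xs) = Some u"
        by (auto simp: bind_eq_Some_conv)
      have "\<forall>\<^sub>F t in sequentially. G (t # m # w # xs) = Suc u"
        using ys(2) by (intro stage_evaluator_complete[OF g _ w(2)]) simp
      with Suc.IH[OF w(1)] show ?case by eventually_elim (simp add: R_def)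
    qed
    then show "\<forall>\<^sub>F t in sequentially. ?S (t # ys) = Suc v" using ev unfolding ys(1) S by blast
  qed
qed

lemma recf_eval_Mu_eq_Some_iff:
  "recf_eval (Mu f) xs = Some v \<longleftrightarrow>
     recf_eval f (v # xs) = Some 0 \<and> (\<forall>y<v. \<exists>w. recf_eval f (y # xs) = Some (Suc w))"
proof -
  have "(LEAST z. recf_eval f (z # xs) = Some 0) = z"
    if "recf_eval f (z # xs) = Some 0" "\<forall>y<z. \<exists>w. recf_eval f (y # xs) = Some (Suc w)" for z
    using that by (intro Least_equality) (auto simp: not_less[symmetric])
  then show ?thesis by auto
qed

text \<open>A value 1 of F means that the result 0 has been seen, a larger one that a nonzero result
  has been seen. At most one z can qualify at a given stage, so the sum has at most one nonzero
  term.\<close>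

lemma stage_evaluator_Mu:
  assumes f: "stage_evaluator f (Suc k) F"
  shows "stage_evaluator (Mu f) k
    (\<lambda>ys. \<Sum>z<ys ! 0. of_bool (F (ys ! 0 # z # drop 1 ys) = 1 \<and>
        (\<forall>y<z. 1 < F (ys ! 0 # y # drop 1 ys))) * Suc z)"
    (is "stage_evaluator _ _ ?S")
proof -
  define P where "P = (\<lambda>t xs z. F (t # z # xs) = 1 \<and> (\<forall>y<z. 1 < F (t # y # xs)))"
  have S: "?S (t # xs) = Suc v \<longleftrightarrow> v < t \<and> P t xs v" for t xs v
  proof -
    have uniq: "z = z'" if "P t xs z" "P t xs z'" for z z'
      using that unfolding P_def by (metis less_irrefl nat_neq_iff)
    have val: "?S (t # xs) = Suc z" if "z < t" "P t xs z" for z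
    proof -
      have "?S (t # xs) = (\<Sum>z<t. of_bool (P t xs z) * Suc z)" by (simp add: P_def)
      also have "\<dots> = (\<Sum>y\<in>{z}. of_bool (P t xs y) * Suc y)"
        using that uniq by (intro sum.mono_neutral_right) auto
      finally show ?thesis using that by simp
    qed
    have "\<exists>z<t. P t xs z" if "?S (t # xs) = Suc v"
    proof (rule ccontr)
      assume "\<not> ?thesis"
      then have "(\<Sum>z<t. of_bool (P t xs z) * Suc z) = 0" by (intro sum.neutral) auto
      then have "?S (t # xs) = 0" by (simp add: P_def)
      from trans[OF that[symmetric] this] show False by simp
    qed
    then show ?thesis using val by auto
  qed
  show ?thesis
  proof (rule stage_evaluatorI)
    have "total_rec_list (Suc (Suc k)) (\<lambda>ys. drop 1 ys ! 0 # ys ! 0 # drop 2 ys)"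
      by (intro total_rec_list_Cons total_rec_list_drop total_rec_nth total_rec_drop_nth) auto
    from total_rec_comp[OF stage_evaluator_total_rec[OF f] this]
    have 1: "total_rec (Suc (Suc k)) (\<lambda>ys. F (drop 1 ys ! 0 # ys ! 0 # drop 1 (drop 1 ys)))"
      by (simp add: numeral_2_eq_2)
    have "total_rec_list (Suc (Suc (Suc k))) (\<lambda>ys. drop 2 ys ! 0 # ys ! 0 # drop 3 ys)"
      by (intro total_rec_list_Cons total_rec_list_drop total_rec_nth total_rec_drop_nth) auto
    from total_rec_comp[OF stage_evaluator_total_rec[OF f] this]
    have 2: "total_rec (Suc (Suc (Suc k)))
        (\<lambda>ys. F (drop 1 (drop 1 ys) ! 0 # ys ! 0 # drop 1 (drop 1 (drop 1 ys))))"
      by (simp add: eval_nat_numeral)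
    show "total_rec (Suc k) ?S"
      by (intro rec_intros 1 2) auto
  next
    fix xs t v assume xs: "length xs = k" and "?S (t # xs) = Suc v"
    then have P: "P t xs v" using S by blast
    then have "recf_eval f (v # xs) = Some 0"
      unfolding P_def using xs by (intro stage_evaluator_sound[OF f, of _ t]) auto
    moreover have "\<exists>w. recf_eval f (y # xs) = Some (Suc w)" if "y < v" for y
    proof -
      have "1 < F (t # y # xs)" using P that unfolding P_def by blast
      then have "F (t # y # xs) = Suc (Suc (F (t # y # xs) - 2))" by simp
      then show ?thesis using xs stage_evaluator_sound[OF f, of "y # xs"] by auto
    qed
    ultimately show "recf_eval (Mu f) xs = Some v" unfolding recf_eval_Mu_eq_Some_iff by blast
  next
    fix xs v assume xs: "length xs = k" and "recf_eval (Mu f) xs = Some v"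
    then have v: "recf_eval f (v # xs) = Some 0"
      "\<And>y. y < v \<Longrightarrow> \<exists>w. recf_eval f (y # xs) = Some (Suc w)"
      unfolding recf_eval_Mu_eq_Some_iff by blast+
    have "\<forall>\<^sub>F t in sequentially. F (t # v # xs) = Suc 0"
      using xs by (intro stage_evaluator_complete[OF f _ v(1)]) simp
    moreover have "\<forall>\<^sub>F t in sequentially. \<forall>y\<in>{..<v}. 1 < F (t # y # xs)"
    proof (intro eventually_ball_finite ballI)
      fix y assume "y \<in> {..<v}"
      then obtain w where "recf_eval f (y # xs) = Some (Suc w)" using v(2) by blast
      then have "\<forall>\<^sub>F t in sequentially. F (t # y # xs) = Suc (Suc w)"
        using xs by (intro stage_evaluator_complete[OF f]) auto
      then show "\<forall>\<^sub>F t in sequentially. 1 < F (t # y # xs)" by eventually_elim simp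
    qed simp
    moreover have "\<forall>\<^sub>F t in sequentially. v < t" by (rule eventually_gt_at_top)
    ultimately have "\<forall>\<^sub>F t in sequentially. v < t \<and> P t xs v"
      by eventually_elim (auto simp: P_def)
    then show "\<forall>\<^sub>F t in sequentially. ?S (t # xs) = Suc v" unfolding S .
  qed
qed

text \<open>A simulator assembled along the structure of the program, in place of a universal
  machine with a step counter. Argument lists that are too short never halt, hence the constant
  0.\<close>

lemma stage_evaluator_exists: "\<exists>S. stage_evaluator r k S"
proof (induction r arbitrary: k)
  case Zero
  show ?case by (intro exI[of _ "\<lambda>_. 1"] stage_evaluatorI total_rec_const) auto
next
  case Succ
  show ?case
  proof (cases k)
    case 0
    then show ?thesis by (intro exI[of _ "\<lambda>_. 0"] stage_evaluatorI total_rec_const) auto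
  next
    case (Suc k')
    then show ?thesis
      by (intro exI[of _ "\<lambda>ys. Suc (Suc (ys ! 1))"] stage_evaluatorI rec_intros)
        (auto simp: length_Suc_conv)
  qed
next
  case (Proj i)
  show ?case
  proof (cases "i < k")
    case True
    then show ?thesis
      by (intro exI[of _ "\<lambda>ys. Suc (ys ! Suc i)"] stage_evaluatorI rec_intros) auto
  next
    case False
    then show ?thesis by (intro exI[of _ "\<lambda>_. 0"] stage_evaluatorI total_rec_const) auto
  qed
next
  case (Comp f gs)
  from Comp.IH(1) obtain F where "stage_evaluator f (length gs) F" by blast
  moreover have "\<forall>g\<in>set gs. \<exists>S. stage_evaluator g k S" using Comp.IH(2) by blast
  then obtain G where "\<forall>g\<in>set gs. stage_evaluator g k (G g)" by (rule bchoice[THEN exE])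
  ultimately show ?case using stage_evaluator_Comp by blast
next
  case (PrimRec f g)
  show ?case
  proof (cases k)
    case 0
    then show ?thesis by (intro exI[of _ "\<lambda>_. 0"] stage_evaluatorI total_rec_const) auto
  next
    case (Suc k')
    then show ?thesis using PrimRec.IH stage_evaluator_PrimRec by blast
  qed
next
  case (Mu f)
  then show ?case using stage_evaluator_Mu by blast
qed

section \<open>Complexity of elements of enumerable sets\<close>

text \<open>The exponent of 2 in s for s > 0; it is smaller than s, so the range of summation misses
  nothing.\<close>

definition twos :: "nat \<Rightarrow> nat" where
  "twos s = (\<Sum>z<s. of_bool (s mod 2 ^ Suc z = 0))"

text \<open>Together with \<open>twos\<close> this inverts the pairing of L and m as 2^L (2 m + 1),
  in which L costs L bits and m about its own length. It serves both to dovetail stages with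
  candidates and to make programs self-delimiting.\<close>

definition odd_half :: "nat \<Rightarrow> nat" where
  "odd_half s = s div 2 ^ twos s div 2"

lemma twos_eq: "twos (2 ^ L * (2 * m + 1)) = L"
proof -
  define s where "s = 2 ^ L * (2 * m + 1)"
  have dvd: "s mod 2 ^ Suc z = 0 \<longleftrightarrow> z < L" for z
  proof
    assume "s mod 2 ^ Suc z = 0"
    then have d: "2 ^ Suc z dvd s" by (simp add: dvd_eq_mod_eq_0)
    show "z < L"
    proof (rule ccontr)
      assume "\<not> z < L"
      then have "(2::nat) ^ Suc L dvd 2 ^ Suc z" by (intro le_imp_power_dvd) simp
      then have "2 ^ Suc L dvd s" using d by (rule dvd_trans)
      then have "2 ^ L * 2 dvd 2 ^ L * (2 * m + 1)" unfolding s_def power_Suc2 .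
      then have "2 dvd 2 * m + 1" by (simp only: nat_mult_dvd_cancel_disj) simp
      then show False by simp
    qed
  next
    assume "z < L"
    then have "(2::nat) ^ Suc z dvd 2 ^ L" by (intro le_imp_power_dvd) simp
    then have "2 ^ Suc z dvd s" unfolding s_def by (rule dvd_mult2)
    then show "s mod 2 ^ Suc z = 0" by (rule dvd_imp_mod_0)
  qed
  have "L < 2 ^ L" by simp
  also have "\<dots> \<le> s" by (simp add: s_def)
  finally have "L < s" .
  then have "{..<s} \<inter> {z. s mod 2 ^ Suc z = 0} = {..<L}" unfolding dvd by auto
  then have "card ({..<s} \<inter> {z. s mod 2 ^ Suc z = 0}) = L" by (simp only: card_lessThan)
  then show ?thesis unfolding twos_def s_def[symmetric] by (simp add: of_bool_def sum.If_cases del: power_Suc)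
qed

lemma odd_half_eq: "odd_half (2 ^ L * (2 * m + 1)) = m"
  unfolding odd_half_def twos_eq by simp

lemma total_rec_twos: "total_rec k a \<Longrightarrow> total_rec k (\<lambda>xs. twos (a xs))"
proof (rule total_rec_comp1[where f = twos])
  show "total_rec 1 (\<lambda>ys. twos (ys ! 0))"
    unfolding twos_def by (intro rec_intros) auto
qed

lemma total_rec_odd_half: "total_rec k a \<Longrightarrow> total_rec k (\<lambda>xs. odd_half (a xs))"
  unfolding odd_half_def by (intro rec_intros total_rec_twos)

text \<open>
  The number \<open>s\<close> stands for the pair of the stage \<open>twos s\<close> and the candidate \<open>odd_half s\<close>.
\<close>

definition first_seen :: "(nat \<Rightarrow> nat \<Rightarrow> bool) \<Rightarrow> nat \<Rightarrow> bool" where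
  "first_seen P s \<longleftrightarrow> P (twos s) (odd_half s) \<and>
     \<not> (\<exists>s'<s. P (twos s') (odd_half s') \<and> odd_half s' = odd_half s)"

text \<open>The rank of x is the number of candidates that appear before it. These and x are
  distinct elements of the enumerated set, hence the strict bound.\<close>

lemma first_seen_index:
  assumes fin: "finite {x. \<exists>t. P t x}" and x: "P t x"
  obtains s where "first_seen P s" "odd_half s = x"
    "card {s'. s' < s \<and> first_seen P s'} < card {x. \<exists>t. P t x}"
proof -
  define Q where "Q = (\<lambda>s. P (twos s) (odd_half s) \<and> odd_half s = x)"
  have "Q (2 ^ t * (2 * x + 1))" unfolding Q_def twos_eq odd_half_eq using x by simp
  then have Q: "Q (Least Q)" by (rule LeastI)
  define s where "s = Least Q"
  have Qs: "P (twos s) (odd_half s)" "odd_half s = x"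
    using Q[folded s_def] unfolding Q_def by blast+
  have "\<not> Q s'" if "s' < s" for s' using not_less_Least that unfolding s_def by blast
  then have s: "first_seen P s" "odd_half s = x"
    using Qs unfolding first_seen_def Q_def by auto
  have inj: "inj_on odd_half {s. first_seen P s}"
  proof (rule inj_onI)
    have *: "\<not> a < b" if "first_seen P a" "first_seen P b" "odd_half a = odd_half b" for a b
      using that unfolding first_seen_def by blast
    fix a b assume "a \<in> {s. first_seen P s}" "b \<in> {s. first_seen P s}" "odd_half a = odd_half b"
    then show "a = b" using *[of a b] *[of b a] by simp
  qed
  have "card {s'. s' < s \<and> first_seen P s'} < card (insert s {s'. s' < s \<and> first_seen P s'})"
    by simp
  also have "\<dots> = card (odd_half ` insert s {s'. s' < s \<and> first_seen P s'})"
    using s(1) by (intro card_image[symmetric] inj_on_subset[OF inj]) auto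
  also have "\<dots> \<le> card {x. \<exists>t. P t x}"
    using s(1) by (intro card_mono fin) (auto simp: first_seen_def)
  finally show thesis using that s by blast
qed

section \<open>Lengths of codes and short programs\<close>

lemma bstring_code_bounds:
  "2 ^ length x \<le> bstring_code x + 1" "bstring_code x + 1 < 2 ^ (length x + 1)"
  by (induction x) (auto simp: algebra_simps)

lemma length_bstring_iff:
  "length x = n \<longleftrightarrow> 2 ^ n \<le> bstring_code x + 1 \<and> bstring_code x + 1 < 2 ^ (n + 1)"
proof
  assume "2 ^ n \<le> bstring_code x + 1 \<and> bstring_code x + 1 < 2 ^ (n + 1)"
  then have "(2::nat) ^ n < 2 ^ (length x + 1)" "(2::nat) ^ length x < 2 ^ (n + 1)"
    using bstring_code_bounds[of x] by linarith+
  then show "length x = n" by (simp del: power_Suc add: power_strict_increasing_iff)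
qed (use bstring_code_bounds[of x] in auto)

lemma bstring_code_eq_iff: "bstring_code x = bstring_code y \<longleftrightarrow> x = y"
  using bij_bstring_code by (auto simp: bij_def inj_eq)

lemma obtain_bstring: obtains x where "bstring_code x = m"
  using bij_bstring_code by (metis bij_pointE)

lemma complexity_le: "V q = Some x \<Longrightarrow> complexity V x \<le> enat (length q)"
  unfolding complexity_def by (intro INF_lower) simp

lemma complexity_lessE:
  assumes "complexity V x < enat k"
  obtains q where "V q = Some x" "length q < k"
  using assms unfolding complexity_def by (auto simp: INF_less_iff)

text \<open>All partiality is confined to one unbounded search: minimise f, then post-process with
  h, both of them total.\<close>

lemma search_language:
  assumes f: "total_rec 2 (\<lambda>ys. f (ys ! 0) (ys ! 1))" and h: "total_rec 2 (\<lambda>ys. h (ys ! 0) (ys ! 1))"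
  obtains V where "computable_language V"
    "\<And>q z x. f z (bstring_code q) = 0 \<Longrightarrow> (\<And>y. y < z \<Longrightarrow> 0 < f y (bstring_code q)) \<Longrightarrow>
      h z (bstring_code q) = bstring_code x \<Longrightarrow> V q = Some x"
proof -
  obtain rf where "\<And>xs. length xs = 2 \<Longrightarrow> recf_eval rf xs = Some (f (xs ! 0) (xs ! 1))"
    using f unfolding total_rec_def by blast
  from this[of "[_, _]"] have rf: "\<And>a b. recf_eval rf [a, b] = Some (f a b)" by simp
  obtain rh where "\<And>xs. length xs = 2 \<Longrightarrow> recf_eval rh xs = Some (h (xs ! 0) (xs ! 1))"
    using h unfolding total_rec_def by blast
  from this[of "[_, _]"] have rh: "\<And>a b. recf_eval rh [a, b] = Some (h a b)" by simp
  define r where "r = Comp rh [Mu rf, Proj 0]"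
  define V where "V = (\<lambda>q. map_option (inv bstring_code) (recf_eval r [bstring_code q]))"
  have inv1: "inv bstring_code (bstring_code x) = x" for x
    using bij_bstring_code by (simp add: bij_def)
  have inv2: "bstring_code (inv bstring_code m) = m" for m
    using bij_bstring_code by (simp add: bij_def surj_f_inv_f)
  have "computable_language V"
    unfolding computable_language_def V_def
    by (intro exI[of _ r] allI) (simp add: option.map_comp comp_def inv2 option.map_ident)
  moreover have "V q = Some x"
    if "f z (bstring_code q) = 0" "\<And>y. y < z \<Longrightarrow> 0 < f y (bstring_code q)"
      "h z (bstring_code q) = bstring_code x" for q z x
  proof -
    have "recf_eval (Mu rf) [bstring_code q] = Some z"
      unfolding recf_eval_Mu_eq_Some_iff rf using that by (auto simp: gr0_conv_Suc)
    then have "recf_eval r [bstring_code q] = Some (bstring_code x)"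
      unfolding r_def using that(3) by (simp add: rh del: recf_eval.simps(6))
    then show ?thesis by (simp add: V_def inv1)
  qed
  ultimately show thesis using that by blast
qed

text \<open>
  The program for \<open>x\<close> is the string whose code is \<open>2\<^sup>L (2 m + 1) - 1\<close>, where the base \<open>2\<^sup>L\<close> digits of
  \<open>m\<close>, least significant first, are \<open>k\<close>, \<open>j\<close>, \<open>n\<close> and then the position of \<open>x\<close> in the enumeration.
\<close>

lemma complexity_enumerable_le:
  assumes U: "optimal_language U"
    and W: "decidable 5 (\<lambda>ys. W (ys ! 0) (ys ! 1) (ys ! 2) (ys ! 3) (ys ! 4))"
  obtains c where "\<And>n j k L l t x. n < 2 ^ L \<Longrightarrow> j < 2 ^ L \<Longrightarrow> k < 2 ^ L \<Longrightarrow>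
    finite {y. \<exists>t. W n j k t y} \<Longrightarrow> card {y. \<exists>t. W n j k t y} \<le> 2 ^ l \<Longrightarrow>
    W n j k t (bstring_code x) \<Longrightarrow> complexity U x \<le> enat (4 * L + l + c)"
proof -
  define base where "base = (\<lambda>c. 2 ^ twos (Suc c) :: nat)"
  define pk where "pk = (\<lambda>c. odd_half (Suc c) mod base c)"
  define pj where "pj = (\<lambda>c. odd_half (Suc c) div base c mod base c)"
  define pn where "pn = (\<lambda>c. odd_half (Suc c) div base c div base c mod base c)"
  define pos where "pos = (\<lambda>c. odd_half (Suc c) div base c div base c div base c)"
  define seen where "seen = (\<lambda>n j k. first_seen (W n j k))"
  \<comment> \<open>Zero exactly where the candidate of rank \<open>pos c\<close> makes its first
    appearance, so that minimisation stops there.\<close>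
  define f where "f = (\<lambda>z c. of_bool (\<not> (seen (pn c) (pj c) (pk c) z \<and>
      (\<Sum>s<z. of_bool (seen (pn c) (pj c) (pk c) s)) = pos c)) :: nat)"
  note base_rec = total_rec_odd_half total_rec_twos
  note W' = decidable_comp5[OF W]
  have seen: "decidable 4 (\<lambda>ys. seen (ys ! 0) (ys ! 1) (ys ! 2) (ys ! 3))"
    unfolding seen_def first_seen_def by (intro W' rec_intros base_rec) auto
  note seen' = decidable_comp4[OF seen]
  have fr: "total_rec 2 (\<lambda>ys. f (ys ! 0) (ys ! 1))"
    unfolding f_def pn_def pj_def pk_def pos_def base_def
    by (intro seen' rec_intros base_rec) auto
  have hr: "total_rec 2 (\<lambda>ys. odd_half (ys ! 0))" by (intro rec_intros base_rec) auto
  obtain V where V: "computable_language V"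
    "\<And>q z x. f z (bstring_code q) = 0 \<Longrightarrow> (\<And>y. y < z \<Longrightarrow> 0 < f y (bstring_code q)) \<Longrightarrow>
      odd_half z = bstring_code x \<Longrightarrow> V q = Some x"
    by (rule search_language[of f "\<lambda>z c. odd_half z", OF fr hr]) blast
  from U V(1) obtain c where c: "\<And>x. complexity U x \<le> complexity V x + enat c"
    unfolding optimal_language_def by blast
  have "complexity U x \<le> enat (4 * L + l + c)"
    if par: "n < 2 ^ L" "j < 2 ^ L" "k < 2 ^ L" and fin: "finite {y. \<exists>t. W n j k t y}"
      and card: "card {y. \<exists>t. W n j k t y} \<le> 2 ^ l" and x: "W n j k t (bstring_code x)"
    for n j k L l t x
  proof -
    let ?P = "W n j k"
    obtain s where s: "first_seen ?P s" "odd_half s = bstring_code x"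
      "card {s'. s' < s \<and> first_seen ?P s'} < card {x. \<exists>t. ?P t x}"
      using first_seen_index[OF fin x] .
    define i where "i = card {s'. s' < s \<and> first_seen ?P s'}"
    have i: "i < 2 ^ l" using s(3) card by (simp add: i_def)
    define w where "w = (2::nat) ^ L"
    define m where "m = ((i * w + n) * w + j) * w + k"
    have w: "0 < w" by (simp add: w_def)
    have dig: "(a * w + b) div w = a" "(a * w + b) mod w = b" if "b < w" for a b
      using that by auto
    have m_bound: "m < 2 ^ l * w ^ 3"
    proof -
      have "i * w + n < 2 ^ l * w"
        using mult_right_mono[of "Suc i" "2 ^ l" w] i par(1) by (simp add: w_def)
      then have "(i * w + n) * w + j < 2 ^ l * w * w"
        using mult_right_mono[of "Suc (i * w + n)" "2 ^ l * w" w] par(2) by (simp add: w_def)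
      then have "m < 2 ^ l * w * w * w"
        using mult_right_mono[of "Suc ((i * w + n) * w + j)" "2 ^ l * w * w" w] par(3)
        by (simp add: w_def m_def)
      then show ?thesis by (simp add: power3_eq_cube mult_ac)
    qed
    obtain q where q: "bstring_code q = w * (2 * m + 1) - 1" by (rule obtain_bstring)
    then have Sq: "Suc (bstring_code q) = 2 ^ L * (2 * m + 1)" using w by (simp add: w_def)
    let ?c = "bstring_code q"
    have b: "base ?c = w" unfolding base_def Sq twos_eq w_def ..
    have o: "odd_half (Suc ?c) = m" unfolding Sq odd_half_eq ..
    have params: "pk ?c = k" "pj ?c = j" "pn ?c = n" "pos ?c = i"
      unfolding pk_def pj_def pn_def pos_def b o m_def
      using par dig by (simp_all add: w_def)
    have count: "(\<Sum>s<z. of_bool (seen n j k s)) = card {s'. s' < z \<and> first_seen ?P s'}" for z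
      unfolding seen_def by (simp add: of_bool_def sum.If_cases lessThan_def Collect_conj_eq)
    have f: "f z ?c = of_bool (\<not> (first_seen ?P z \<and> card {s'. s' < z \<and> first_seen ?P s'} = i))" for z
      unfolding f_def params count by (simp add: seen_def)
    have "V q = Some x"
    proof (rule V(2)[of s])
      show "f s ?c = 0" unfolding f using s(1) by (simp add: i_def)
      show "0 < f y ?c" if "y < s" for y
      proof -
        \<comment> \<open>An earlier first appearance has smaller rank, because it is itself counted
          among those before \<open>s\<close>.\<close>
        have "card {s'. s' < y \<and> first_seen ?P s'} < i" if "first_seen ?P y"
          unfolding i_def using \<open>y < s\<close> that by (intro psubset_card_mono psubsetI) auto
        then show ?thesis unfolding f by auto
      qed
    qed (fact s(2))
    then have "complexity V x \<le> enat (length q)" by (rule complexity_le)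
    moreover have "length q \<le> 4 * L + l"
    proof -
      \<comment> \<open>One block of L bits marks the width, three hold k, j and n, and l bits hold
        the rank; a bound strictly below 2^(4 L + l + 1) gives length at most 4 L + l.\<close>
      have "(2::nat) ^ length q \<le> 2 ^ L * (2 * m + 1)" using bstring_code_bounds(1)[of q] Sq by simp
      also have "\<dots> < 2 ^ L * (2 * (2 ^ l * w ^ 3))"
        using m_bound by (intro mult_strict_left_mono) auto
      also have "w ^ 3 = 2 ^ (3 * L)" by (simp add: w_def mult.commute flip: power_mult)
      also have "2 ^ L * (2 * (2 ^ l * 2 ^ (3 * L))) = (2::nat) ^ (L + (1 + (l + 3 * L)))"
        by (simp only: power_add power_one_right)
      also have "L + (1 + (l + 3 * L)) = 4 * L + l + 1" by simp
      finally show ?thesis by (simp del: power_Suc add: power_strict_increasing_iff)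
    qed
    ultimately have "complexity V x \<le> enat (4 * L + l)" by (meson enat_ord_simps(1) order_trans)
    then have "complexity V x + enat c \<le> enat (4 * L + l) + enat c" by (rule add_right_mono)
    then show ?thesis using c[of x] by (metis order_trans plus_enat_simps(1))
  qed
  then show thesis using that by blast
qed

text \<open>\<open>Suc (bstring_code x)\<close> is \<open>x\<close> in binary, least significant bit first, followed by a final 1.\<close>

definition code_hamming :: "nat \<Rightarrow> nat \<Rightarrow> nat \<Rightarrow> nat" where
  "code_hamming n a b = (\<Sum>i<n. of_bool (Suc a div 2 ^ i mod 2 \<noteq> Suc b div 2 ^ i mod 2))"

lemma code_hamming_bstring_code:
  "length x = n \<Longrightarrow> length y = n \<Longrightarrow>
    code_hamming n (bstring_code x) (bstring_code y) = hamming x y"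
proof (induction n arbitrary: x y)
  case (Suc n)
  then obtain a x' b y' where xy: "x = a # x'" "y = b # y'" "length x' = n" "length y' = n"
    by (auto simp: length_Suc_conv)
  have S: "Suc (bstring_code (a # x)) = 2 * Suc (bstring_code x) + of_bool a" for a x by simp
  have d: "(2 * m + of_bool a) div 2 ^ Suc i = m div 2 ^ i" for m i :: nat and a
    by (simp add: div_mult2_eq)
  have "code_hamming (Suc n) (bstring_code x) (bstring_code y) =
      of_bool (a \<noteq> b) + code_hamming n (bstring_code x') (bstring_code y')"
    unfolding code_hamming_def xy sum.lessThan_Suc_shift S d by (auto simp: mod_mult_self2 simp del: Suc_eq_plus1)
  then show ?case using Suc.IH[OF xy(3,4)] by (simp add: xy)
qed (simp add: code_hamming_def)

lemma flip_prob_hamming: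
  "length x = length y \<Longrightarrow> flip_prob \<tau> x y = \<tau> ^ hamming x y * (1 - \<tau>) ^ (length x - hamming x y)"
proof (induction x y rule: list_induct2)
  case (Cons a x b y)
  then show ?case using hamming_le_length[of x y] by (simp add: Suc_diff_le)
qed simp

section \<open>Strings that noise makes simple\<close>

lemma noise_Cons:
  "noise \<tau> (a # x) =
     bind_pmf (bernoulli_pmf \<tau>) (\<lambda>e. map_pmf ((#) (a \<noteq> e)) (noise \<tau> x))"
  unfolding noise_def by (simp add: map_pmf_def bind_assoc_pmf bind_return_pmf)

lemma pmf_noise:
  assumes "0 \<le> \<tau>" "\<tau> \<le> 1"
  shows "pmf (noise \<tau> x) y = flip_prob \<tau> x y"
proof (induction x arbitrary: y)
  case Nil
  show ?case by (cases y) (auto simp: noise_def)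
next
  case (Cons a x)
  have "pmf (noise \<tau> (a # x)) y = \<tau> * pmf (map_pmf ((#) (a \<noteq> True)) (noise \<tau> x)) y +
      (1 - \<tau>) * pmf (map_pmf ((#) (a \<noteq> False)) (noise \<tau> x)) y"
    unfolding noise_Cons pmf_bind using assms by (subst integral_bernoulli_pmf) auto
  moreover have "pmf (map_pmf ((#) c) M) (b # z) = (if b = c then pmf M z else 0)"
    for c b :: bool and M z
  proof (cases "b = c")
    case True
    then show ?thesis by (simp add: pmf_map_inj')
  next
    case False
    then show ?thesis by (auto intro!: pmf_map_outside)
  qed
  moreover have "pmf (map_pmf ((#) c) M) [] = 0" for c :: bool and M
    by (rule pmf_map_outside) auto
  ultimately show ?case using Cons.IH by (cases y) auto
qed

lemma prob_noise:
  assumes "0 \<le> \<tau>" "\<tau> \<le> 1" "x \<in> words n"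
  shows "measure_pmf.prob (noise \<tau> x) S = (\<Sum>y\<in>S \<inter> words n. flip_prob \<tau> x y)"
proof -
  have zero: "flip_prob \<tau> x y = 0" if "length x \<noteq> length y" for x y
    using that by (induction \<tau> x y rule: flip_prob.induct) auto
  have "set_pmf (noise \<tau> x) \<subseteq> words n"
  proof
    fix y assume "y \<in> set_pmf (noise \<tau> x)"
    then have "flip_prob \<tau> x y \<noteq> 0" using assms by (simp add: set_pmf_iff pmf_noise)
    then show "y \<in> words n" using zero[of x y] assms(3) by (fastforce simp: words_def)
  qed
  then have "S \<inter> words n \<inter> set_pmf (noise \<tau> x) = S \<inter> set_pmf (noise \<tau> x)" by auto
  then have "measure_pmf.prob (noise \<tau> x) S = measure_pmf.prob (noise \<tau> x) (S \<inter> words n)"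
    by (metis measure_Int_set_pmf)
  also have "\<dots> = (\<Sum>y\<in>S \<inter> words n. pmf (noise \<tau> x) y)"
    by (rule measure_measure_pmf_finite) simp
  finally show ?thesis using assms by (simp add: pmf_noise)
qed

definition low_complexity :: "(bstring \<Rightarrow> bstring option) \<Rightarrow> nat \<Rightarrow> nat \<Rightarrow> bstring set" where
  "low_complexity U n k = {y \<in> words n. complexity U y < enat k}"

lemma finite_low_complexity [simp]: "finite (low_complexity U n k)"
  by (simp add: low_complexity_def)

lemma length_less_iff_code: "length q < k \<longleftrightarrow> Suc (bstring_code q) < 2 ^ k"
proof
  assume "length q < k"
  then have "(2::nat) ^ (length q + 1) \<le> 2 ^ k" by (intro power_increasing) auto
  then show "Suc (bstring_code q) < 2 ^ k" using bstring_code_bounds(2)[of q] by simp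
next
  assume "Suc (bstring_code q) < 2 ^ k"
  then have "(2::nat) ^ length q < 2 ^ k" using bstring_code_bounds(1)[of q] by linarith
  then show "length q < k" by (rule power_less_imp_less_exp[rotated]) simp
qed

lemma card_low_complexity: "card (low_complexity U n k) \<le> 2 ^ k"
proof -
  have sub: "bstring_code ` {q. length q < k} \<subseteq> {..<2 ^ k}"
    by (auto simp: length_less_iff_code)
  have inj: "inj_on bstring_code {q. length q < k}" by (rule inj_onI) (simp add: bstring_code_eq_iff)
  have fin: "finite {q :: bstring. length q < k}"
    using sub inj by (meson finite_imageD finite_lessThan finite_subset)
  have "low_complexity U n k \<subseteq> (\<lambda>q. the (U q)) ` {q. length q < k}"
    unfolding low_complexity_def by (force elim!: complexity_lessE)
  then have "card (low_complexity U n k) \<le> card {q :: bstring. length q < k}"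
    using fin by (meson card_image_le card_mono finite_imageI order_trans)
  also have "\<dots> = card (bstring_code ` {q. length q < k})" by (rule card_image[OF inj, symmetric])
  also have "\<dots> \<le> card {..<(2::nat) ^ k}" using sub by (intro card_mono) auto
  finally show ?thesis by simp
qed

text \<open>
  With noise level \<open>j / n\<^sup>2\<close> membership amounts to an inequality between integers. The threshold is
  \<open>1 / (2 n)\<close> instead of \<open>1 / n\<close> to make up for rounding \<open>\<tau>\<close> to such a level.
\<close>

definition noisy_candidates :: "(bstring \<Rightarrow> bstring option) \<Rightarrow> nat \<Rightarrow> nat \<Rightarrow> nat \<Rightarrow> bstring set" where
  "noisy_candidates U n j k = {x \<in> words n.
     1 / (2 * real n) \<le> (\<Sum>y\<in>low_complexity U n k. flip_prob (real j / real (n * n)) x y)}"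

text \<open>Clearing denominators with (n^2)^n turns transition probabilities into natural numbers,
  which a recursive function can compare exactly.\<close>

lemma flip_prob_rational:
  assumes "length x = n" "length y = n" "1 \<le> n" "j \<le> n * n"
  shows "real (j ^ hamming x y * (n * n - j) ^ (n - hamming x y)) =
    real ((n * n) ^ n) * flip_prob (real j / real (n * n)) x y"
proof -
  have h: "hamming x y \<le> n" using hamming_le_length[of x y] assms by simp
  define M where "M = real (n * n)"
  have M: "0 < M" using assms by (simp add: M_def)
  have "1 - real j / M = (M - real j) / M" using M by (simp add: field_simps)
  moreover have "real (n * n - j) = M - real j" using assms(4) by (simp add: M_def of_nat_diff)
  moreover have "M ^ n = M ^ hamming x y * M ^ (n - hamming x y)" using h by (simp flip: power_add)
  moreover have "flip_prob (real j / real (n * n)) x y =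
      (real j / M) ^ hamming x y * (1 - real j / M) ^ (n - hamming x y)"
    using assms by (simp add: flip_prob_hamming M_def)
  moreover have "real ((n * n) ^ n) = M ^ n" by (simp only: M_def of_nat_power)
  ultimately show ?thesis
    using M by (simp add: power_divide)
qed

text \<open>The low-complexity words are only enumerable, so their total transition probability is
  approximated from below by the words found at stage t. The terms are nonnegative and some stage
  finds all these words; hence x is a candidate iff it passes the test at some stage.\<close>

lemma complexity_noisy_candidates_le:
  assumes U: "optimal_language U"
  obtains c where "\<And>n j k L l x. n < 2 ^ L \<Longrightarrow> j < 2 ^ L \<Longrightarrow> k < 2 ^ L \<Longrightarrow> 1 \<le> n \<Longrightarrow> j \<le> n * n \<Longrightarrow>
    card (noisy_candidates U n j k) \<le> 2 ^ l \<Longrightarrow> x \<in> noisy_candidates U n j k \<Longrightarrow>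
    complexity U x \<le> enat (4 * L + l + c)"
proof -
  from U obtain r where r: "\<And>q. recf_eval r [bstring_code q] = map_option bstring_code (U q)"
    unfolding optimal_language_def computable_language_def by blast
  obtain S where S: "stage_evaluator r 1 S" using stage_evaluator_exists by blast
  define T where "T = (\<lambda>t q. S [t, q])"
  have T_rec: "total_rec 2 (\<lambda>ys. T (ys ! 0) (ys ! 1))"
  proof -
    have "total_rec 2 S" using stage_evaluator_total_rec[OF S] by (simp add: numeral_2_eq_2)
    then show ?thesis
      by (rule total_rec_cong) (auto simp: T_def numeral_2_eq_2 length_Suc_conv)
  qed
  have T_sound: "U q = Some y" if "T t (bstring_code q) = Suc (bstring_code y)" for t q y
  proof -
    have "recf_eval r [bstring_code q] = Some (bstring_code y)"
      using that by (intro stage_evaluator_sound[OF S, of _ t]) (auto simp: T_def)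
    then show ?thesis unfolding r by (auto simp: bstring_code_eq_iff)
  qed
  have T_complete: "\<forall>\<^sub>F t in sequentially. T t (bstring_code q) = Suc (bstring_code y)"
    if "U q = Some y" for q y
    unfolding T_def using that by (intro stage_evaluator_complete[OF S]) (auto simp: r)
  \<comment> \<open>\<open>Suc q < 2 ^ k\<close> expresses that the program with code
    \<open>q\<close> is shorter than \<open>k\<close>; the bound \<open>q < 2 ^ k\<close> follows
    from it and makes the quantifier bounded.\<close>
  define found where "found = (\<lambda>n k t y. 2 ^ n \<le> Suc y \<and> Suc y < 2 ^ Suc n \<and>
      (\<exists>q<2 ^ k. Suc q < 2 ^ k \<and> T t q = Suc y))"
  \<comment> \<open>The threshold inequality multiplied by 2 n (n^2)^n. Codes of words of length n
    lie below 2 ^ Suc n.\<close>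
  define W where "W = (\<lambda>n j k t x. 2 ^ n \<le> Suc x \<and> Suc x < 2 ^ Suc n \<and>
      (n * n) ^ n \<le> 2 * n * (\<Sum>y<2 ^ Suc n. of_bool (found n k t y) *
        (j ^ code_hamming n x y * (n * n - j) ^ (n - code_hamming n x y))))"
  have found_dec: "decidable 4 (\<lambda>ys. found (ys ! 0) (ys ! 1) (ys ! 2) (ys ! 3))"
    unfolding found_def by (intro rec_intros total_rec_comp2[OF T_rec]) auto
  have ch: "total_rec 3 (\<lambda>ys. code_hamming (ys ! 0) (ys ! 1) (ys ! 2))"
    unfolding code_hamming_def by (intro rec_intros) auto
  have "decidable 5 (\<lambda>ys. W (ys ! 0) (ys ! 1) (ys ! 2) (ys ! 3) (ys ! 4))"
    unfolding W_def by (intro rec_intros decidable_comp4[OF found_dec] total_rec_comp3[OF ch]) auto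
  then obtain c where c: "\<And>n j k L l t x. n < 2 ^ L \<Longrightarrow> j < 2 ^ L \<Longrightarrow> k < 2 ^ L \<Longrightarrow>
    finite {y. \<exists>t. W n j k t y} \<Longrightarrow> card {y. \<exists>t. W n j k t y} \<le> 2 ^ l \<Longrightarrow>
    W n j k t (bstring_code x) \<Longrightarrow> complexity U x \<le> enat (4 * L + l + c)"
    using complexity_enumerable_le[OF U] by blast
  define B where "B = (\<lambda>n k t. {y \<in> words n. found n k t (bstring_code y)})"
  have words_iff: "y \<in> words n \<longleftrightarrow> 2 ^ n \<le> Suc (bstring_code y) \<and> Suc (bstring_code y) < 2 ^ Suc n" for y n
    using length_bstring_iff[of y n] by (simp add: words_def)
  have found_iff: "found n k t (bstring_code y) \<longleftrightarrow>
      y \<in> words n \<and> (\<exists>q. length q < k \<and> T t (bstring_code q) = Suc (bstring_code y))" for n k t y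
  proof -
    have "(\<exists>q<2 ^ k. Suc q < 2 ^ k \<and> T t q = Suc (bstring_code y)) \<longleftrightarrow>
        (\<exists>q. length q < k \<and> T t (bstring_code q) = Suc (bstring_code y))"
      unfolding length_less_iff_code by (metis Suc_lessD obtain_bstring)
    then show ?thesis unfolding found_def words_iff by blast
  qed
  have B_sub: "B n k t \<subseteq> low_complexity U n k" for n k t
  proof
    fix y assume "y \<in> B n k t"
    then obtain q where q: "y \<in> words n" "length q < k" "T t (bstring_code q) = Suc (bstring_code y)"
      unfolding B_def found_iff by blast
    have "complexity U y \<le> enat (length q)" using T_sound[OF q(3)] by (rule complexity_le)
    also have "\<dots> < enat k" using q(2) by simp
    finally show "y \<in> low_complexity U n k" using q(1) by (simp add: low_complexity_def)
  qed
  have B_eq: "\<exists>t. B n k t = low_complexity U n k" for n k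
  proof -
    \<comment> \<open>The set is finite, so one stage finds all of its elements.\<close>
    have "\<forall>\<^sub>F t in sequentially. \<forall>y\<in>low_complexity U n k. y \<in> B n k t"
    proof (intro eventually_ball_finite ballI)
      fix y assume y: "y \<in> low_complexity U n k"
      then obtain q where q: "U q = Some y" "length q < k"
        unfolding low_complexity_def by (auto elim: complexity_lessE)
      from T_complete[OF q(1)] show "\<forall>\<^sub>F t in sequentially. y \<in> B n k t"
        by eventually_elim (use q(2) y in \<open>auto simp: B_def found_iff low_complexity_def\<close>)
    qed simp
    from eventually_happens'[OF sequentially_bot this]
    obtain t where "\<forall>y\<in>low_complexity U n k. y \<in> B n k t" ..
    then show ?thesis using B_sub[of n k t] by blast
  qed
  have W_iff: "W n j k t (bstring_code x) \<longleftrightarrow> x \<in> words n \<and>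
      1 / (2 * real n) \<le> (\<Sum>y\<in>B n k t. flip_prob (real j / real (n * n)) x y)"
    if n: "1 \<le> n" and j: "j \<le> n * n" for n j k t x
  proof (cases "x \<in> words n")
    case False
    then show ?thesis unfolding W_def words_iff by blast
  next
    case x: True
    let ?g = "\<lambda>y. j ^ code_hamming n (bstring_code x) y * (n * n - j) ^ (n - code_hamming n (bstring_code x) y)"
    let ?s = "\<Sum>y\<in>B n k t. flip_prob (real j / real (n * n)) x y"
    have set: "{y \<in> {..<2 ^ Suc n}. found n k t y} = bstring_code ` B n k t"
    proof (intro set_eqI iffI)
      fix y assume y: "y \<in> {y \<in> {..<2 ^ Suc n}. found n k t y}"
      obtain y' where "bstring_code y' = y" by (rule obtain_bstring)
      with y show "y \<in> bstring_code ` B n k t" unfolding B_def using found_iff by blast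
    next
      fix y assume "y \<in> bstring_code ` B n k t"
      then show "y \<in> {y \<in> {..<2 ^ Suc n}. found n k t y}"
        unfolding B_def by (auto simp: found_def)
    qed
    have "(\<Sum>y<2 ^ Suc n. of_bool (found n k t y) * ?g y) = (\<Sum>y\<in>{y \<in> {..<2 ^ Suc n}. found n k t y}. ?g y)"
      by (rule sum.mono_neutral_cong_right) auto
    also have "\<dots> = (\<Sum>y\<in>B n k t. ?g (bstring_code y))"
      unfolding set by (subst sum.reindex) (auto intro!: inj_onI simp: bstring_code_eq_iff)
    finally have "real (\<Sum>y<2 ^ Suc n. of_bool (found n k t y) * ?g y) =
        (\<Sum>y\<in>B n k t. real (?g (bstring_code y)))" by (simp only: of_nat_sum)
    also have "\<dots> = (\<Sum>y\<in>B n k t. real ((n * n) ^ n) * flip_prob (real j / real (n * n)) x y)"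
    proof (rule sum.cong[OF refl])
      fix y assume "y \<in> B n k t"
      then have l: "length x = n" "length y = n" using x by (auto simp: B_def words_def)
      show "real (?g (bstring_code y)) = real ((n * n) ^ n) * flip_prob (real j / real (n * n)) x y"
        unfolding code_hamming_bstring_code[OF l] by (rule flip_prob_rational[OF l n j])
    qed
    also have "\<dots> = real ((n * n) ^ n) * ?s" by (simp only: sum_distrib_left)
    finally have sum: "real (\<Sum>y<2 ^ Suc n. of_bool (found n k t y) * ?g y) = real ((n * n) ^ n) * ?s" .
    have "W n j k t (bstring_code x) \<longleftrightarrow>
        (n * n) ^ n \<le> 2 * n * (\<Sum>y<2 ^ Suc n. of_bool (found n k t y) * ?g y)"
      using x unfolding W_def words_iff by blast
    also have "\<dots> \<longleftrightarrow> real ((n * n) ^ n) \<le>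
        real (2 * n) * real (\<Sum>y<2 ^ Suc n. of_bool (found n k t y) * ?g y)"
      by (simp only: of_nat_le_iff flip: of_nat_mult)
    also have "\<dots> \<longleftrightarrow> real ((n * n) ^ n) * 1 \<le> real ((n * n) ^ n) * (real (2 * n) * ?s)"
      unfolding sum by (simp only: mult_ac mult_1_right mult_1_left)
    also have "\<dots> \<longleftrightarrow> 1 \<le> real (2 * n) * ?s"
      using n by (subst mult_le_cancel_left_pos) auto
    also have "\<dots> \<longleftrightarrow> 1 / (2 * real n) \<le> ?s" using n by (simp add: pos_divide_le_eq mult_ac)
    finally show ?thesis using x by simp
  qed
  have set_W: "{y. \<exists>t. W n j k t y} = bstring_code ` noisy_candidates U n j k"
    if n: "1 \<le> n" and j: "j \<le> n * n" for n j k
  proof -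
    have *: "(\<exists>t. W n j k t (bstring_code x)) \<longleftrightarrow> x \<in> noisy_candidates U n j k" for x
    proof
      assume "\<exists>t. W n j k t (bstring_code x)"
      then obtain t where t: "x \<in> words n"
        "1 / (2 * real n) \<le> (\<Sum>y\<in>B n k t. flip_prob (real j / real (n * n)) x y)"
        using W_iff[OF n j] by blast
      note t(2)
      also have "(\<Sum>y\<in>B n k t. flip_prob (real j / real (n * n)) x y)
          \<le> (\<Sum>y\<in>low_complexity U n k. flip_prob (real j / real (n * n)) x y)"
      proof (rule sum_mono2[OF finite_low_complexity B_sub])
        have "real j \<le> real (n * n)" using j by (simp only: of_nat_le_iff)
        then show "0 \<le> flip_prob (real j / real (n * n)) x y" for y
          by (intro flip_prob_nonneg) (auto intro: divide_le_eq_1[THEN iffD2] simp del: of_nat_mult)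
      qed
      finally show "x \<in> noisy_candidates U n j k" using t(1) by (simp add: noisy_candidates_def)
    next
      assume x: "x \<in> noisy_candidates U n j k"
      obtain t where "B n k t = low_complexity U n k" using B_eq by blast
      then have "W n j k t (bstring_code x)"
        using W_iff[OF n j] x by (simp add: noisy_candidates_def)
      then show "\<exists>t. W n j k t (bstring_code x)" ..
    qed
    show ?thesis
    proof (intro set_eqI iffI)
      fix y assume y: "y \<in> {y. \<exists>t. W n j k t y}"
      obtain x where x: "bstring_code x = y" by (rule obtain_bstring)
      then have "x \<in> noisy_candidates U n j k" using y * by blast
      then show "y \<in> bstring_code ` noisy_candidates U n j k" using x by blast
    qed (use * in blast)
  qed
  have "complexity U x \<le> enat (4 * L + l + c)"
    if "n < 2 ^ L" "j < 2 ^ L" "k < 2 ^ L" and n: "1 \<le> n" and j: "j \<le> n * n"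
      and card: "card (noisy_candidates U n j k) \<le> 2 ^ l" and x: "x \<in> noisy_candidates U n j k"
    for n j k L l x
  proof -
    have fin: "finite (noisy_candidates U n j k)" by (simp add: noisy_candidates_def)
    have "bstring_code x \<in> {y. \<exists>t. W n j k t y}" unfolding set_W[OF n j] using x by simp
    then obtain t where t: "W n j k t (bstring_code x)" by blast
    have "card {y. \<exists>t. W n j k t y} = card (noisy_candidates U n j k)"
      unfolding set_W[OF n j] by (rule card_image) (auto intro!: inj_onI simp: bstring_code_eq_iff)
    then show ?thesis
      using c[OF that(1-3) _ _ t] fin card unfolding set_W[OF n j] by simp
  qed
  then show thesis using that by blast
qed

section \<open>Rounding the noise level and the error budget\<close>

text \<open>Rounding down can only enlarge the factors 1 - \<tau>, so a loss comes from \<tau>^d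
  alone. By Bernoulli's inequality what remains is at least the fraction 1 - n / (\<tau> n^2), which
  is at least 1 / 2 for n >= 2 / \<tau>.\<close>

lemma flip_prob_approx:
  assumes \<tau>: "0 < \<tau>" "\<tau> \<le> 1" and \<sigma>: "\<tau> - 1 / (real n)\<^sup>2 \<le> \<sigma>" "\<sigma> \<le> \<tau>"
    and n: "2 / \<tau> \<le> real n" and l: "length x = n" "length y = n"
  shows "flip_prob \<tau> x y \<le> 2 * flip_prob \<sigma> x y"
proof -
  have n0: "0 < real n" using \<tau> n by (smt (verit) divide_pos_pos)
  define d where "d = hamming x y"
  have d: "d \<le> n" using hamming_le_length[of x y] l by (simp add: d_def)
  define \<epsilon> where "\<epsilon> = 1 / (\<tau> * (real n)\<^sup>2)"
  have \<epsilon>: "0 \<le> \<epsilon>" "real n * \<epsilon> \<le> 1 / 2"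
  proof -
    show "0 \<le> \<epsilon>" using \<tau> by (simp add: \<epsilon>_def)
    have "2 \<le> \<tau> * real n" using n \<tau> by (simp add: field_simps)
    then have "1 / (\<tau> * real n) \<le> 1 / 2" by (intro divide_left_mono) auto
    then show "real n * \<epsilon> \<le> 1 / 2" using n0 by (simp add: \<epsilon>_def power2_eq_square)
  qed
  have "1 \<le> real n" using n0 by simp
  then have \<epsilon>1: "\<epsilon> \<le> 1" using \<epsilon> mult_right_mono[of 1 "real n" \<epsilon>] by linarith
  have \<sigma>': "\<tau> * (1 - \<epsilon>) \<le> \<sigma>"
    using \<sigma>(1) \<tau> by (simp add: \<epsilon>_def right_diff_distrib)
  have "1 / 2 \<le> 1 + real d * (- \<epsilon>)"
    using \<epsilon> mult_right_mono[of "real d" "real n" \<epsilon>] d by simp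
  also have "\<dots> \<le> (1 + - \<epsilon>) ^ d" using \<epsilon>1 by (intro Bernoulli_inequality) simp
  finally have b: "1 / 2 \<le> (1 - \<epsilon>) ^ d" by simp
  have "\<tau> ^ d * (1 / 2) \<le> \<tau> ^ d * (1 - \<epsilon>) ^ d" using b \<tau> by (intro mult_left_mono) auto
  also have "\<dots> = (\<tau> * (1 - \<epsilon>)) ^ d" by (simp add: power_mult_distrib)
  also have "\<dots> \<le> \<sigma> ^ d" using \<sigma>' \<tau> \<epsilon>1 by (intro power_mono) auto
  finally have 1: "\<tau> ^ d \<le> 2 * \<sigma> ^ d" by simp
  have \<sigma>0: "0 \<le> \<sigma>"
  proof -
    have "0 \<le> \<tau> * (1 - \<epsilon>)" using \<tau> \<epsilon>1 by simp
    then show ?thesis using \<sigma>' by linarith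
  qed
  have 2: "(1 - \<tau>) ^ (n - d) \<le> (1 - \<sigma>) ^ (n - d)" using \<sigma> \<tau> by (intro power_mono) auto
  have "\<tau> ^ d * (1 - \<tau>) ^ (n - d) \<le> (2 * \<sigma> ^ d) * (1 - \<sigma>) ^ (n - d)"
    using 1 2 \<tau> \<sigma>0 by (intro mult_mono) auto
  then show ?thesis using l by (simp add: flip_prob_hamming d_def)
qed

text \<open>The final estimate collects the constants 1 (rounding \<tau>), 1 and 4 (rounding l and
  L), 1 (rounding k) and 2 (entropy of a concentrated law), 9 in all besides c, so 13 leaves room.
  The last term, from the thickening, forces an exponent above 1/2.\<close>

lemma eventually_margin:
  "\<forall>\<^sub>F n in sequentially. 13 + c + 4 * log 2 ((real n)\<^sup>2 + 1) +
     (sqrt (2 * real n * ln (2 * real n)) + 1) * log 2 (real n + 1) < real n powr (3 / 4)"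
proof -
  have "(\<lambda>n. 13 + c + 4 * log 2 ((real n)\<^sup>2 + 1) +
     (sqrt (2 * real n * ln (2 * real n)) + 1) * log 2 (real n + 1)) \<in> o(\<lambda>n. real n powr (3 / 4))"
    by real_asymp
  then have "\<forall>\<^sub>F n in sequentially. norm (13 + c + 4 * log 2 ((real n)\<^sup>2 + 1) +
     (sqrt (2 * real n * ln (2 * real n)) + 1) * log 2 (real n + 1)) \<le> 1 / 2 * norm (real n powr (3 / 4))"
    by (rule landau_o.smallD) simp
  then show ?thesis using eventually_gt_at_top[of 0]
  proof eventually_elim
    case (elim n)
    then have "0 < real n powr (3 / 4)" by simp
    moreover have "13 + c + 4 * log 2 ((real n)\<^sup>2 + 1) +
        (sqrt (2 * real n * ln (2 * real n)) + 1) * log 2 (real n + 1) \<le> 1 / 2 * norm (real n powr (3 / 4))"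
      using elim(1) unfolding real_norm_def by linarith
    moreover have "norm (real n powr (3 / 4)) = real n powr (3 / 4)" by simp
    ultimately show ?case by linarith
  qed
qed

theorem theorem2:
  fixes U :: "bstring \<Rightarrow> bstring option"
  assumes "optimal_language U"
  shows "\<exists>g :: nat \<Rightarrow> real.
    (\<forall>n. 0 \<le> g n) \<and>
    (\<lambda>n. g n / real n) \<longlonglongrightarrow> 0 \<and>
    (\<forall>p \<tau> \<alpha> \<beta> :: real.
       0 \<le> p \<longrightarrow> p \<le> 1 / 2 \<longrightarrow> 0 < \<tau> \<longrightarrow> \<tau> < 1 \<longrightarrow>
       \<alpha> = binary_entropy p \<longrightarrow> \<beta> = binary_entropy (noisy_param p \<tau>) \<longrightarrow>
       (\<forall>\<^sub>F n in sequentially. \<forall>x :: bstring.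
          length x = n \<longrightarrow> ereal_of_enat (complexity U x) \<ge> ereal (\<alpha> * real n) \<longrightarrow>
          measure_pmf.prob (noise \<tau> x)
            {y. ereal_of_enat (complexity U y) \<ge> ereal (\<beta> * real n - g n)}
          \<ge> 1 - 1 / real n))"
proof -
  define g :: "nat \<Rightarrow> real" where "g = (\<lambda>n. real n powr (3 / 4))"
  obtain c where c: "\<And>n j k L l x. n < 2 ^ L \<Longrightarrow> j < 2 ^ L \<Longrightarrow> k < 2 ^ L \<Longrightarrow> 1 \<le> n \<Longrightarrow> j \<le> n * n \<Longrightarrow>
    card (noisy_candidates U n j k) \<le> 2 ^ l \<Longrightarrow> x \<in> noisy_candidates U n j k \<Longrightarrow>
    complexity U x \<le> enat (4 * L + l + c)"
    using complexity_noisy_candidates_le[OF assms] by blast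
  have main: "\<forall>\<^sub>F n in sequentially. \<forall>x :: bstring.
      length x = n \<longrightarrow> ereal_of_enat (complexity U x) \<ge> ereal (binary_entropy p * real n) \<longrightarrow>
      measure_pmf.prob (noise \<tau> x)
        {y. ereal_of_enat (complexity U y) \<ge> ereal (binary_entropy (noisy_param p \<tau>) * real n - g n)}
      \<ge> 1 - 1 / real n"
    if p: "0 \<le> p" "p \<le> 1 / 2" and \<tau>: "0 < \<tau>" "\<tau> < 1" for p \<tau>
  proof -
    define q where "q = noisy_param p \<tau>"
    \<comment> \<open>Strictness comes from 0 < \<tau> < 1, also for p = 0. It makes H
      differentiable at q, as needed for the rounding of \<tau>.\<close>
    have q: "0 < q" "q < 1"
    proof -
      have "0 \<le> p * (1 - \<tau>)" "0 < (1 - p) * \<tau>" using p \<tau> by (auto intro: mult_pos_pos)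
      then show "0 < q" by (simp add: q_def noisy_param_def)
      have "0 \<le> p * \<tau>" "0 < (1 - p) * (1 - \<tau>)" using p \<tau> by (auto intro: mult_pos_pos)
      moreover have "1 - q = p * \<tau> + (1 - p) * (1 - \<tau>)"
        by (simp add: q_def noisy_param_def algebra_simps)
      ultimately show "q < 1" by linarith
    qed
    \<comment> \<open>Rounding is downwards because \<open>flip_prob_approx\<close> requires
      \<sigma> n <= \<tau>.\<close>
    define j where "j = (\<lambda>n. nat \<lfloor>\<tau> * (real n)\<^sup>2\<rfloor>)"
    define \<sigma> where "\<sigma> = (\<lambda>n. real (j n) / real (n * n))"
    have j: "real (j n) \<le> \<tau> * (real n)\<^sup>2" "\<tau> * (real n)\<^sup>2 - 1 \<le> real (j n)" for n
      using \<tau> by (auto simp: j_def)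
    have \<sigma>: "\<tau> - 1 / (real n)\<^sup>2 \<le> \<sigma> n" "\<sigma> n \<le> \<tau>" "0 \<le> \<sigma> n" if "1 \<le> n" for n
    proof -
      define M where "M = (real n)\<^sup>2"
      have M: "0 < M" using that by (simp add: M_def)
      have \<sigma>M: "\<sigma> n = real (j n) / M" by (simp add: \<sigma>_def M_def power2_eq_square)
      have "(\<tau> * M - 1) / M \<le> \<sigma> n" "\<sigma> n \<le> \<tau> * M / M"
        unfolding \<sigma>M using j[of n, folded M_def] M by (intro divide_right_mono; simp)+
      then show "\<tau> - 1 / (real n)\<^sup>2 \<le> \<sigma> n" "\<sigma> n \<le> \<tau>"
        using M by (auto simp: diff_divide_distrib M_def)
      show "0 \<le> \<sigma> n" by (simp add: \<sigma>_def)
    qed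
    \<comment> \<open>The substitute value q is there for n = 0, where the required error bound is 1
      / 0 = 0.\<close>
    have "\<forall>\<^sub>F n in sequentially.
        \<bar>binary_entropy (if 1 \<le> n then noisy_param p (\<sigma> n) else q) - binary_entropy q\<bar> * real n \<le> 1"
    proof (rule binary_entropy_approx[OF q])
      fix n
      show "\<bar>(if 1 \<le> n then noisy_param p (\<sigma> n) else q) - q\<bar> \<le> 1 / (real n)\<^sup>2"
      proof (cases "1 \<le> n")
        case True
        have "noisy_param p (\<sigma> n) - q = (1 - 2 * p) * (\<sigma> n - \<tau>)"
          by (simp add: q_def noisy_param_def algebra_simps)
        then have "\<bar>noisy_param p (\<sigma> n) - q\<bar> = (1 - 2 * p) * \<bar>\<sigma> n - \<tau>\<bar>"
          using p by (simp add: abs_mult)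
        also have "\<dots> \<le> 1 * \<bar>\<sigma> n - \<tau>\<bar>" using p by (intro mult_right_mono) auto
        also have "\<dots> \<le> 1 / (real n)\<^sup>2" using \<sigma>[OF True] by simp
        finally show ?thesis using True by simp
      qed simp
    qed
    moreover have "\<forall>\<^sub>F n in sequentially. max 1 (2 / \<tau>) \<le> real n"
      using filterlim_real_sequentially unfolding filterlim_at_top by blast
    moreover note eventually_margin[of "real c"]
    ultimately show ?thesis
    proof eventually_elim
      case (elim n)
      have n: "1 \<le> n" "1 \<le> real n" "2 / \<tau> \<le> real n" using elim(2) by auto
      define \<beta> where "\<beta> = binary_entropy q"
      have \<beta>: "\<beta> \<le> 1" using binary_entropy_le_1 q by (simp add: \<beta>_def)
      have close: "\<beta> * real n - 1 \<le> binary_entropy (noisy_param p (\<sigma> n)) * real n"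
      proof -
        have "\<bar>binary_entropy (noisy_param p (\<sigma> n)) - \<beta>\<bar> * real n \<le> 1"
          using elim(1) n by (simp add: \<beta>_def)
        moreover have "(\<beta> - binary_entropy (noisy_param p (\<sigma> n))) * real n \<le>
            \<bar>binary_entropy (noisy_param p (\<sigma> n)) - \<beta>\<bar> * real n"
          by (intro mult_right_mono) auto
        ultimately show ?thesis by (simp add: left_diff_distrib)
      qed
      have "1 - 1 / real n \<le> measure_pmf.prob (noise \<tau> x)
          {y. ereal (\<beta> * real n - g n) \<le> ereal_of_enat (complexity U y)}" (is "_ \<le> measure_pmf.prob _ ?E")
        if x: "x \<in> words n" and Cx: "ereal (binary_entropy p * real n) \<le> ereal_of_enat (complexity U x)" for x
      proof (rule ccontr)
        assume "\<not> ?thesis"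
        then have "1 / real n < measure_pmf.prob (noise \<tau> x) (- ?E)"
          using measure_pmf.prob_compl[of ?E "noise \<tau> x"] by (simp add: Compl_eq_Diff_UNIV)
        also have "\<dots> = (\<Sum>y\<in>- ?E \<inter> words n. flip_prob \<tau> x y)"
          using \<tau> x by (intro prob_noise) auto
        finally have mass: "1 / real n < (\<Sum>y\<in>- ?E \<inter> words n. flip_prob \<tau> x y)" .
        \<comment> \<open>Complexities are integers, so lying below the real threshold is lying
          below its ceiling. The use of \<open>nat\<close> is harmless: a failing event is nonempty,
          which makes the threshold positive.\<close>
        define k where "k = nat \<lceil>\<beta> * real n - g n\<rceil>"
        have low: "y \<in> low_complexity U n k \<and> 0 < \<beta> * real n - g n" if "y \<in> - ?E \<inter> words n" for y
        proof -
          have lt: "ereal_of_enat (complexity U y) < ereal (\<beta> * real n - g n)" using that by auto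
          then obtain m where m: "complexity U y = enat m" by (cases "complexity U y") auto
          then have "real m < \<beta> * real n - g n" using lt by simp
          then show ?thesis using that m by (auto simp: low_complexity_def k_def) linarith
        qed
        have "- ?E \<inter> words n \<noteq> {}" using mass n by auto
        then have pos: "0 < \<beta> * real n - g n" using low by blast
        then have k: "real k \<le> \<beta> * real n - g n + 1" by (simp add: k_def)
        have "g n \<ge> 0" by (simp add: g_def)
        \<comment> \<open>By \<beta> <= 1 the threshold is at most n, so that k fits into L
          bits.\<close>
        have "\<beta> * real n \<le> real n" using \<beta> n by (simp add: mult_left_le_one_le)
        then have "\<lceil>\<beta> * real n - g n\<rceil> \<le> int n"
          using \<open>g n \<ge> 0\<close> unfolding ceiling_le_iff by simp
        then have kn: "k \<le> n" by (simp only: k_def nat_le_iff)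
        have jn: "j n \<le> n * n"
        proof -
          have "\<tau> * (real n)\<^sup>2 \<le> 1 * (real n)\<^sup>2" using \<tau> by (intro mult_right_mono) auto
          then have "real (j n) \<le> 1 * (real n)\<^sup>2" using j(1)[of n] by linarith
          then have "real (j n) \<le> real (n * n)" by (simp add: power2_eq_square)
          then show ?thesis by (simp only: of_nat_le_iff)
        qed
        define A where "A = noisy_candidates U n (j n) k"
        have \<sigma>01: "0 \<le> \<sigma> n" "\<sigma> n \<le> 1" using \<sigma>[OF n(1)] \<tau> by auto
        have xA: "x \<in> A"
        proof -
          have "(\<Sum>y\<in>- ?E \<inter> words n. flip_prob \<tau> x y) \<le> (\<Sum>y\<in>low_complexity U n k. flip_prob \<tau> x y)"
            using low \<tau> by (intro sum_mono2 flip_prob_nonneg) auto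
          with mass have "1 / real n \<le> (\<Sum>y\<in>low_complexity U n k. flip_prob \<tau> x y)" by linarith
          \<comment> \<open>The factor 2 lost to rounding is the gap between the thresholds 1 / n
            and 1 / (2 n).\<close>
          also have "\<dots> \<le> (\<Sum>y\<in>low_complexity U n k. 2 * flip_prob (\<sigma> n) x y)"
            using \<sigma>[OF n(1)] \<tau> n x
            by (intro sum_mono flip_prob_approx[where n = n]) (auto simp: low_complexity_def words_def)
          also have "\<dots> = 2 * (\<Sum>y\<in>low_complexity U n k. flip_prob (\<sigma> n) x y)"
            by (simp only: sum_distrib_left)
          finally have "1 / (2 * real n) \<le> (\<Sum>y\<in>low_complexity U n k. flip_prob (\<sigma> n) x y)" by simp
          then show ?thesis using x by (simp add: A_def noisy_candidates_def \<sigma>_def)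
        qed
        have A: "A \<subseteq> words n" by (auto simp: A_def noisy_candidates_def)
        then have "finite A" by (rule finite_subset) simp
        then have cA: "1 \<le> real (card A)" using xA by (auto simp: Suc_le_eq card_gt_0_iff)
        define l where "l = nat \<lceil>log 2 (real (card A))\<rceil>"
        have l: "log 2 (real (card A)) \<le> real l" "real l \<le> log 2 (real (card A)) + 1"
          using cA by (auto simp: l_def)
        have cl: "card A \<le> 2 ^ l"
        proof -
          have "real (card A) = 2 powr log 2 (real (card A))" using cA by simp
          also have "\<dots> \<le> 2 powr real l" using l by (intro powr_mono) auto
          finally have "real (card A) \<le> real (2 ^ l)" by (simp add: powr_realpow)
          then show ?thesis by (simp only: of_nat_le_iff)
        qed
        have "0 \<le> log 2 ((real n)\<^sup>2 + 1)" by (rule zero_le_log_cancel_iff[THEN iffD2]) (auto intro: add_nonneg_pos)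
        \<comment> \<open>L bits must hold n, k and j n, all of which are at most n^2.\<close>
        define L where "L = nat \<lceil>log 2 ((real n)\<^sup>2 + 1)\<rceil>"
        have L: "log 2 ((real n)\<^sup>2 + 1) \<le> real L" "real L \<le> log 2 ((real n)\<^sup>2 + 1) + 1"
          using \<open>0 \<le> log 2 ((real n)\<^sup>2 + 1)\<close> by (auto simp: L_def real_nat_ceiling_ge)
        have nL: "n * n < 2 ^ L"
        proof -
          have "0 < (real n)\<^sup>2 + 1" by (intro add_nonneg_pos) auto
          then have "(real n)\<^sup>2 + 1 = 2 powr log 2 ((real n)\<^sup>2 + 1)" by simp
          also have "\<dots> \<le> 2 powr real L" using L by (intro powr_mono) auto
          finally have "real (n * n + 1) \<le> real (2 ^ L)" by (simp add: powr_realpow power2_eq_square)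
          then have "n * n + 1 \<le> 2 ^ L" by (simp only: of_nat_le_iff)
          then show ?thesis by simp
        qed
        have "n \<le> n * n" using n by simp
        then have "n < 2 ^ L" "j n < 2 ^ L" "k < 2 ^ L" using nL jn kn by linarith+
        then have "complexity U x \<le> enat (4 * L + l + c)"
          using n(1) jn cl xA unfolding A_def by (rule c)
        then have "ereal_of_enat (complexity U x) \<le> ereal (4 * real L + real l + real c)"
          by (cases "complexity U x") auto
        with Cx have "ereal (binary_entropy p * real n) \<le> ereal (4 * real L + real l + real c)"
          by (rule order_trans)
        \<comment> \<open>The complexity hypothesis on this single x, set against its short
          description as a member of A, shows that A is large.\<close>
        then have "binary_entropy p * real n - (4 * real L + 1 + real c) \<le> log 2 (real (card A))"
          using l by simp
        define r where "r = nat \<lceil>sqrt (2 * real n * ln (2 * real n))\<rceil>"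
        have r: "sqrt (2 * real n * ln (2 * real n)) \<le> real r"
          "real r \<le> sqrt (2 * real n * ln (2 * real n)) + 1"
          using n by (auto simp: r_def)
        have "binary_entropy (noisy_param p (\<sigma> n)) * real n - (4 * real L + 1 + real c)
            \<le> 2 + log 2 (real (card (low_complexity U n k))) + real r * log 2 (real n + 1)"
        proof (rule card_noisy_target_ge[OF p \<sigma>01 n(1) A _ _ _ r(1)])
          show "A \<noteq> {}" using xA by blast
          show "low_complexity U n k \<subseteq> words n" by (auto simp: low_complexity_def)
          show "1 / (2 * real n) \<le> (\<Sum>y\<in>low_complexity U n k. flip_prob (\<sigma> n) x y)" if "x \<in> A" for x
            using that by (simp add: A_def noisy_candidates_def \<sigma>_def)
        qed (use \<open>_ \<le> log 2 (real (card A))\<close> in auto)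
        moreover have "log 2 (real (card (low_complexity U n k))) \<le> real k"
        proof (cases "card (low_complexity U n k) = 0")
          case False
          have "real (card (low_complexity U n k)) \<le> real (2 ^ k)"
            using card_low_complexity by (simp only: of_nat_le_iff)
          then have "log 2 (real (card (low_complexity U n k))) \<le> log 2 (2 ^ k)"
            using False by (intro Transcendental.log_mono) auto
          then show ?thesis by (simp add: log_nat_power)
        \<comment> \<open>An empty set is covered by the default value
          \<open>log 2 0 = 0\<close>.\<close>
        qed (simp add: log_def)
        moreover have "real r * log 2 (real n + 1) \<le>
            (sqrt (2 * real n * ln (2 * real n)) + 1) * log 2 (real n + 1)"
          using r(2) n by (intro mult_right_mono) auto
        moreover have "13 + real c + 4 * log 2 ((real n)\<^sup>2 + 1) +
            (sqrt (2 * real n * ln (2 * real n)) + 1) * log 2 (real n + 1) < g n"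
          using elim(3) by (simp add: g_def)
        ultimately show False using k close L(2) by linarith
      qed
      then show ?case by (simp add: words_def \<beta>_def q_def)
    qed
  qed
  have "(\<lambda>n. g n / real n) \<longlonglongrightarrow> 0" unfolding g_def by real_asymp
  then show ?thesis using main by (intro exI[of _ g]) (auto simp: g_def)
qed

end
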